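(* Let $\mathcal C$ be a $\mathbf{gr}$-category closed under shifts. Suppose $S^0:\mathcal C^0\to\mathcal C^0$ is a right Serre $\Bbbk$-functor. Then there exists a right Serre $\mathbf{gr}$-functor $S:\mathcal C\to\mathcal C$ such that $N_*(S)=S^0$.
   Context: $\Bbbk$ is a commutative ring with unity. $\mathbf{gr}$ is the closed symmetric monoidal category of $\mathbb Z$-graded $\Bbbk$-modules, with unit $\Bbbk$ (in degree 0), signed symmetry $x\otimes y\mapsto(-1)^{\deg x\deg y}y\otimes x$, and inner hom $\underline{\mathbf{gr}}(X,Y)^n=\prod_d\mathrm{Hom}_{\Bbbk}(X^d,Y^{d+n})$. For a $\mathbf{gr}$-category $\mathcal C$, $\mathcal C^0=N_*(\mathcal C)$ denotes the $\Bbbk$-linear category with the same objects and with morphisms the degree 0 components $\mathcal C(X,Y)^0$; for a $\mathbf{gr}$-functor $S$, $N_*(S)$ is its restriction to degree 0 components. Composition in categories is written left to right, $\mu_{\mathcal C}:\mathcal C(X,Y)\otimes\mathcal C(Y,Z)\to\mathcal C(X,Z)$. Closed under shifts. $M[n]^k=M^{k+n}$ and $s^n:M\to M[n]$ is the identity map, of degree $-n$, acting on the right. The $\mathbf{gr}$-category $\mathcal C^{[\,]}$ has objects $(X,n)$ with $X\in\mathrm{Ob}\,\mathcal C$, $n\in\mathbb Z$, morphisms $\mathcal C^{[\,]}((X,n),(Y,m))=\mathcal C(X,Y)[m-n]$, and composition $(s^{m-n}\otimes s^{p-m})^{-1}\mu_{\mathcal C}s^{p-n}$, i.e. $xs^{m-n}\otimes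 ys^{p-m}\mapsto(-1)^{(m-n)\deg y}(xy)s^{p-n}$ for homogeneous $x\in\mathcal C(X,Y)$, $y\in\mathcal C(Y,Z)$. $\mathcal C$ is closed under shifts if every object $(X,n)$ of $\mathcal C^{[\,]}$ is isomorphic in $\mathcal C^{[\,]}$ to some object $(Y,0)$, $Y\in\mathrm{Ob}\,\mathcal C$. For a closed symmetric monoidal category $\mathcal V$ with unit $\mathbf 1$ and inner hom $\underline{\mathcal V}$, a right Serre functor of a $\mathcal V$-category $\mathcal C$ is a $\mathcal V$-functor $S:\mathcal C\to\mathcal C$ (written $Y\mapsto YS$) for which there are isomorphisms $\psi_{X,Y}:\mathcal C(X,YS)\to\underline{\mathcal V}(\mathcal C(Y,X),\mathbf 1)$ in $\mathcal V$, $\mathcal V$-natural in $X$ and $Y$. Right Serre $\Bbbk$-functors are those for $\mathcal V=\Bbbk\text{-Mod}$. *)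

theory Defs
  imports "HOL-Algebra.Module" "HOL-Library.FuncSet"
begin

section \<open>Modules and graded modules\<close>

definition lin_map :: "'r ring \<Rightarrow> ('r, 'm) module \<Rightarrow> ('r, 'n) module \<Rightarrow> ('m \<Rightarrow> 'n) \<Rightarrow> bool" where
  "lin_map R M N f \<longleftrightarrow>
     f \<in> carrier M \<rightarrow> carrier N \<and>
     (\<forall>x\<in>carrier M. \<forall>y\<in>carrier M. f (x \<oplus>\<^bsub>M\<^esub> y) = f x \<oplus>\<^bsub>N\<^esub> f y) \<and>
     (\<forall>a\<in>carrier R. \<forall>x\<in>carrier M. f (a \<odot>\<^bsub>M\<^esub> x) = a \<odot>\<^bsub>N\<^esub> f x)"

text \<open>The module of linear maps. Its elements are extensional functions, so that equality in the
  module is equality of maps on the carrier. The ring multiplication and unit, which are fields of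
  every module record, play no role in the theory of modules.\<close>

definition lin_hom :: "'r ring \<Rightarrow> ('r, 'm) module \<Rightarrow> ('r, 'n) module \<Rightarrow> ('r, 'm \<Rightarrow> 'n) module" where
  "lin_hom R M N =
     \<lparr>carrier = {f \<in> extensional (carrier M). lin_map R M N f},
      mult = undefined, one = undefined,
      zero = (\<lambda>x\<in>carrier M. \<zero>\<^bsub>N\<^esub>),
      add = (\<lambda>f g. \<lambda>x\<in>carrier M. f x \<oplus>\<^bsub>N\<^esub> g x),
      smult = (\<lambda>a f. \<lambda>x\<in>carrier M. a \<odot>\<^bsub>N\<^esub> f x)\<rparr>"

definition lin_iso :: "'r ring \<Rightarrow> ('r, 'm) module \<Rightarrow> ('r, 'n) module \<Rightarrow> ('m \<Rightarrow> 'n) set" where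
  "lin_iso R M N = {f \<in> carrier (lin_hom R M N). bij_betw f (carrier M) (carrier N)}"

definition ring_module :: "'r ring \<Rightarrow> ('r, 'r) module" where
  "ring_module R =
     \<lparr>carrier = carrier R, mult = mult R, one = one R, zero = zero R, add = add R, smult = mult R\<rparr>"

type_synonym ('r, 'm) gr_module = "int \<Rightarrow> ('r, 'm) module"

text \<open>The unit object: the base ring in degree 0, and the zero module elsewhere.\<close>

definition gr_unit :: "'r ring \<Rightarrow> ('r, 'r) gr_module" where
  "gr_unit R d =
     (if d = 0 then ring_module R else (ring_module R)\<lparr>carrier := {\<zero>\<^bsub>R\<^esub>}\<rparr>)"

definition gr_shift :: "('r, 'm) gr_module \<Rightarrow> int \<Rightarrow> ('r, 'm) gr_module" where
  "gr_shift M n k = M (k + n)"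

text \<open>The inner hom. An element of degree \<open>n\<close> is a family whose \<open>d\<close>-th member is a linear map
  from \<open>M d\<close> to \<open>N (d + n)\<close>.\<close>

definition gr_hom ::
  "'r ring \<Rightarrow> ('r, 'm) gr_module \<Rightarrow> ('r, 'n) gr_module \<Rightarrow> ('r, int \<Rightarrow> 'm \<Rightarrow> 'n) gr_module" where
  "gr_hom R M N n =
     (let H = (\<lambda>d. lin_hom R (M d) (N (d + n))) in
      \<lparr>carrier = {f. \<forall>d. f d \<in> carrier (H d)},
       mult = undefined, one = undefined,
       zero = (\<lambda>d. \<zero>\<^bsub>H d\<^esub>),
       add = (\<lambda>f g d. f d \<oplus>\<^bsub>H d\<^esub> g d),
       smult = (\<lambda>a f d. a \<odot>\<^bsub>H d\<^esub> f d)\<rparr>)"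

text \<open>Composition \<open>f g\<close>, written left to right, of inner hom elements where \<open>f\<close> has source \<open>M\<close> and
  degree \<open>n\<close>. Maps act on the right of their arguments, so no sign appears.\<close>

definition gr_comp ::
  "('r, 'm) gr_module \<Rightarrow> int \<Rightarrow> (int \<Rightarrow> 'm \<Rightarrow> 'n) \<Rightarrow> (int \<Rightarrow> 'n \<Rightarrow> 'p) \<Rightarrow> int \<Rightarrow> 'm \<Rightarrow> 'p" where
  "gr_comp M n f g = (\<lambda>d. \<lambda>x\<in>carrier (M d). g (d + n) (f d x))"

definition gr_iso ::
  "'r ring \<Rightarrow> ('r, 'm) gr_module \<Rightarrow> ('r, 'n) gr_module \<Rightarrow> (int \<Rightarrow> 'm \<Rightarrow> 'n) set" where
  "gr_iso R M N =
     {f \<in> carrier (gr_hom R M N 0). \<forall>d. bij_betw (f d) (carrier (M d)) (carrier (N d))}"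

text \<open>\<open>gr_sgn M k x\<close> is \<open>(-1)^k x\<close> in the module \<open>M\<close>.\<close>

definition gr_sgn :: "('r, 'm) module \<Rightarrow> int \<Rightarrow> 'm \<Rightarrow> 'm" where
  "gr_sgn M k x = (if even k then x else \<ominus>\<^bsub>M\<^esub> x)"


section \<open>Linear categories\<close>

text \<open>Composition is written left to right throughout: \<open>kComp C X Y Z f g\<close> is \<open>f : X \<rightarrow> Y\<close> followed
  by \<open>g : Y \<rightarrow> Z\<close>. Hom modules of different pairs of objects need not be disjoint, hence the object
  arguments of composition and of the action of functors on morphisms.\<close>

record ('o, 'r, 'm) k_cat =
  kObj :: "'o set"
  kHom :: "'o \<Rightarrow> 'o \<Rightarrow> ('r, 'm) module"
  kComp :: "'o \<Rightarrow> 'o \<Rightarrow> 'o \<Rightarrow> 'm \<Rightarrow> 'm \<Rightarrow> 'm"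
  kId :: "'o \<Rightarrow> 'm"

locale k_category =
  fixes R :: "'r ring" and C :: "('o, 'r, 'm) k_cat"
  assumes base_ring: "cring R"
    and hom_module: "\<lbrakk>X \<in> kObj C; Y \<in> kObj C\<rbrakk> \<Longrightarrow> module R (kHom C X Y)"
    and comp_linear_right:
      "\<lbrakk>X \<in> kObj C; Y \<in> kObj C; Z \<in> kObj C; f \<in> carrier (kHom C X Y)\<rbrakk>
        \<Longrightarrow> lin_map R (kHom C Y Z) (kHom C X Z) (\<lambda>g. kComp C X Y Z f g)"
    and comp_linear_left:
      "\<lbrakk>X \<in> kObj C; Y \<in> kObj C; Z \<in> kObj C; g \<in> carrier (kHom C Y Z)\<rbrakk>
        \<Longrightarrow> lin_map R (kHom C X Y) (kHom C X Z) (\<lambda>f. kComp C X Y Z f g)"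
    and comp_assoc:
      "\<lbrakk>X \<in> kObj C; Y \<in> kObj C; Z \<in> kObj C; W \<in> kObj C;
        f \<in> carrier (kHom C X Y); g \<in> carrier (kHom C Y Z); h \<in> carrier (kHom C Z W)\<rbrakk>
        \<Longrightarrow> kComp C X Z W (kComp C X Y Z f g) h = kComp C X Y W f (kComp C Y Z W g h)"
    and id_closed: "X \<in> kObj C \<Longrightarrow> kId C X \<in> carrier (kHom C X X)"
    and id_left:
      "\<lbrakk>X \<in> kObj C; Y \<in> kObj C; f \<in> carrier (kHom C X Y)\<rbrakk> \<Longrightarrow> kComp C X X Y (kId C X) f = f"
    and id_right:
      "\<lbrakk>X \<in> kObj C; Y \<in> kObj C; f \<in> carrier (kHom C X Y)\<rbrakk> \<Longrightarrow> kComp C X Y Y f (kId C Y) = f"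

definition k_isomorphic :: "('o, 'r, 'm) k_cat \<Rightarrow> 'o \<Rightarrow> 'o \<Rightarrow> bool" where
  "k_isomorphic C X Y \<longleftrightarrow>
     X \<in> kObj C \<and> Y \<in> kObj C \<and>
     (\<exists>f\<in>carrier (kHom C X Y). \<exists>g\<in>carrier (kHom C Y X).
        kComp C X Y X f g = kId C X \<and> kComp C Y X Y g f = kId C Y)"

definition k_op :: "('o, 'r, 'm) k_cat \<Rightarrow> ('o, 'r, 'm) k_cat" where
  "k_op C =
     \<lparr>kObj = kObj C,
      kHom = (\<lambda>X Y. kHom C Y X),
      kComp = (\<lambda>X Y Z f g. kComp C Z Y X g f),
      kId = kId C\<rparr>"

record ('o, 'p, 'm, 'n) k_fun =
  kOn :: "'o \<Rightarrow> 'p"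
  kMap :: "'o \<Rightarrow> 'o \<Rightarrow> 'm \<Rightarrow> 'n"

locale k_functor = dom: k_category R C + cod: k_category R D
  for R :: "'r ring" and C :: "('o, 'r, 'm) k_cat" and D :: "('p, 'r, 'n) k_cat" +
  fixes F :: "('o, 'p, 'm, 'n) k_fun"
  assumes on_obj: "X \<in> kObj C \<Longrightarrow> kOn F X \<in> kObj D"
    and map_linear:
      "\<lbrakk>X \<in> kObj C; Y \<in> kObj C\<rbrakk> \<Longrightarrow> lin_map R (kHom C X Y) (kHom D (kOn F X) (kOn F Y)) (kMap F X Y)"
    and map_comp:
      "\<lbrakk>X \<in> kObj C; Y \<in> kObj C; Z \<in> kObj C;
        f \<in> carrier (kHom C X Y); g \<in> carrier (kHom C Y Z)\<rbrakk>
        \<Longrightarrow> kMap F X Z (kComp C X Y Z f g)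
          = kComp D (kOn F X) (kOn F Y) (kOn F Z) (kMap F X Y f) (kMap F Y Z g)"
    and map_id: "X \<in> kObj C \<Longrightarrow> kMap F X X (kId C X) = kId D (kOn F X)"

definition k_fun_op :: "('o, 'p, 'm, 'n) k_fun \<Rightarrow> ('o, 'p, 'm, 'n) k_fun" where
  "k_fun_op F = \<lparr>kOn = kOn F, kMap = (\<lambda>X Y. kMap F Y X)\<rparr>"

definition k_fun_comp :: "('o, 'p, 'm, 'n) k_fun \<Rightarrow> ('p, 'q, 'n, 'l) k_fun \<Rightarrow> ('o, 'q, 'm, 'l) k_fun" where
  "k_fun_comp F G =
     \<lparr>kOn = (\<lambda>X. kOn G (kOn F X)),
      kMap = (\<lambda>X Y f. kMap G (kOn F X) (kOn F Y) (kMap F X Y f))\<rparr>"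

text \<open>Module-valued functors: the representable functors \<open>C(X, -)\<close> on \<open>C\<close> and \<open>C(-, Y)\<close> on the
  opposite of \<open>C\<close>, and the duality functor from the opposite category of modules to modules.\<close>

definition k_hom_from ::
  "('o, 'r, 'm) k_cat \<Rightarrow> 'o \<Rightarrow> ('o, ('r, 'm) module, 'm, 'm \<Rightarrow> 'm) k_fun" where
  "k_hom_from C X =
     \<lparr>kOn = (\<lambda>Y. kHom C X Y),
      kMap = (\<lambda>Y Y' g. \<lambda>z\<in>carrier (kHom C X Y). kComp C X Y Y' z g)\<rparr>"

definition k_hom_into ::
  "('o, 'r, 'm) k_cat \<Rightarrow> 'o \<Rightarrow> ('o, ('r, 'm) module, 'm, 'm \<Rightarrow> 'm) k_fun" where
  "k_hom_into C Y =
     \<lparr>kOn = (\<lambda>X. kHom C X Y),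
      kMap = (\<lambda>X X' f. \<lambda>z\<in>carrier (kHom C X Y). kComp C X' X Y f z)\<rparr>"

definition k_dual ::
  "'r ring \<Rightarrow> (('r, 'm) module, ('r, 'm \<Rightarrow> 'r) module, 'm \<Rightarrow> 'm, ('m \<Rightarrow> 'r) \<Rightarrow> 'm \<Rightarrow> 'r) k_fun" where
  "k_dual R =
     \<lparr>kOn = (\<lambda>M. lin_hom R M (ring_module R)),
      kMap = (\<lambda>N M h. \<lambda>p\<in>carrier (lin_hom R N (ring_module R)). \<lambda>x\<in>carrier M. p (h x))\<rparr>"

text \<open>Naturality of a family of linear maps between two module-valued functors.\<close>

definition k_natural ::
  "'r ring \<Rightarrow> ('o, 'r, 'm) k_cat \<Rightarrow>
   ('o, ('r, 'a) module, 'm, 'a \<Rightarrow> 'a) k_fun \<Rightarrow> ('o, ('r, 'b) module, 'm, 'b \<Rightarrow> 'b) k_fun \<Rightarrow>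
   ('o \<Rightarrow> 'a \<Rightarrow> 'b) \<Rightarrow> bool" where
  "k_natural R C F G \<alpha> \<longleftrightarrow>
     (\<forall>X\<in>kObj C. \<alpha> X \<in> carrier (lin_hom R (kOn F X) (kOn G X))) \<and>
     (\<forall>X\<in>kObj C. \<forall>Y\<in>kObj C. \<forall>f\<in>carrier (kHom C X Y). \<forall>w\<in>carrier (kOn F X).
        \<alpha> Y (kMap F X Y f w) = kMap G X Y f (\<alpha> X w))"

definition right_serre_k_functor ::
  "'r ring \<Rightarrow> ('o, 'r, 'm) k_cat \<Rightarrow> ('o, 'o, 'm, 'm) k_fun \<Rightarrow> bool" where
  "right_serre_k_functor R C S \<longleftrightarrow>
     k_functor R C C S \<and>
     (\<exists>\<psi>.
        (\<forall>X\<in>kObj C. \<forall>Y\<in>kObj C.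
           \<psi> X Y \<in> lin_iso R (kHom C X (kOn S Y)) (lin_hom R (kHom C Y X) (ring_module R))) \<and>
        (\<forall>Y\<in>kObj C.
           k_natural R (k_op C)
             (k_hom_into C (kOn S Y))
             (k_fun_comp (k_fun_op (k_hom_from C Y)) (k_dual R))
             (\<lambda>X. \<psi> X Y)) \<and>
        (\<forall>X\<in>kObj C.
           k_natural R C
             (k_fun_comp S (k_hom_from C X))
             (k_fun_comp (k_fun_op (k_hom_into C X)) (k_dual R))
             (\<lambda>Y. \<psi> X Y)))"


section \<open>Graded categories\<close>

text \<open>The degrees of the two morphisms composed are arguments of the composition, because the
  homogeneous components of a hom object need not be disjoint either.\<close>

record ('o, 'r, 'm) gr_cat =
  gObj :: "'o set"
  gHom :: "'o \<Rightarrow> 'o \<Rightarrow> ('r, 'm) gr_module"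
  gComp :: "'o \<Rightarrow> 'o \<Rightarrow> 'o \<Rightarrow> int \<Rightarrow> int \<Rightarrow> 'm \<Rightarrow> 'm \<Rightarrow> 'm"
  gId :: "'o \<Rightarrow> 'm"

text \<open>A morphism from a tensor product of graded modules amounts to bilinear maps of homogeneous
  components, and a morphism from the unit object to an element of degree 0.\<close>

locale gr_category =
  fixes R :: "'r ring" and C :: "('o, 'r, 'm) gr_cat"
  assumes base_ring: "cring R"
    and hom_module: "\<lbrakk>X \<in> gObj C; Y \<in> gObj C\<rbrakk> \<Longrightarrow> module R (gHom C X Y d)"
    and comp_linear_right:
      "\<lbrakk>X \<in> gObj C; Y \<in> gObj C; Z \<in> gObj C; f \<in> carrier (gHom C X Y d)\<rbrakk>
        \<Longrightarrow> lin_map R (gHom C Y Z e) (gHom C X Z (d + e)) (\<lambda>g. gComp C X Y Z d e f g)"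
    and comp_linear_left:
      "\<lbrakk>X \<in> gObj C; Y \<in> gObj C; Z \<in> gObj C; g \<in> carrier (gHom C Y Z e)\<rbrakk>
        \<Longrightarrow> lin_map R (gHom C X Y d) (gHom C X Z (d + e)) (\<lambda>f. gComp C X Y Z d e f g)"
    and comp_assoc:
      "\<lbrakk>X \<in> gObj C; Y \<in> gObj C; Z \<in> gObj C; W \<in> gObj C;
        f \<in> carrier (gHom C X Y d); g \<in> carrier (gHom C Y Z e); h \<in> carrier (gHom C Z W l)\<rbrakk>
        \<Longrightarrow> gComp C X Z W (d + e) l (gComp C X Y Z d e f g) h
          = gComp C X Y W d (e + l) f (gComp C Y Z W e l g h)"
    and id_closed: "X \<in> gObj C \<Longrightarrow> gId C X \<in> carrier (gHom C X X 0)"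
    and id_left:
      "\<lbrakk>X \<in> gObj C; Y \<in> gObj C; f \<in> carrier (gHom C X Y d)\<rbrakk> \<Longrightarrow> gComp C X X Y 0 d (gId C X) f = f"
    and id_right:
      "\<lbrakk>X \<in> gObj C; Y \<in> gObj C; f \<in> carrier (gHom C X Y d)\<rbrakk> \<Longrightarrow> gComp C X Y Y d 0 f (gId C Y) = f"

text \<open>The symmetry of graded modules contributes the Koszul sign.\<close>

definition gr_op :: "('o, 'r, 'm) gr_cat \<Rightarrow> ('o, 'r, 'm) gr_cat" where
  "gr_op C =
     \<lparr>gObj = gObj C,
      gHom = (\<lambda>X Y. gHom C Y X),
      gComp = (\<lambda>X Y Z d e f g. gr_sgn (gHom C Z X (d + e)) (d * e) (gComp C Z Y X e d g f)),
      gId = gId C\<rparr>"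

record ('o, 'p, 'm, 'n) gr_fun =
  gOn :: "'o \<Rightarrow> 'p"
  gMap :: "'o \<Rightarrow> 'o \<Rightarrow> int \<Rightarrow> 'm \<Rightarrow> 'n"

locale gr_functor = dom: gr_category R C + cod: gr_category R D
  for R :: "'r ring" and C :: "('o, 'r, 'm) gr_cat" and D :: "('p, 'r, 'n) gr_cat" +
  fixes F :: "('o, 'p, 'm, 'n) gr_fun"
  assumes on_obj: "X \<in> gObj C \<Longrightarrow> gOn F X \<in> gObj D"
    and map_linear:
      "\<lbrakk>X \<in> gObj C; Y \<in> gObj C\<rbrakk>
        \<Longrightarrow> lin_map R (gHom C X Y d) (gHom D (gOn F X) (gOn F Y) d) (gMap F X Y d)"
    and map_comp:
      "\<lbrakk>X \<in> gObj C; Y \<in> gObj C; Z \<in> gObj C;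
        f \<in> carrier (gHom C X Y d); g \<in> carrier (gHom C Y Z e)\<rbrakk>
        \<Longrightarrow> gMap F X Z (d + e) (gComp C X Y Z d e f g)
          = gComp D (gOn F X) (gOn F Y) (gOn F Z) d e (gMap F X Y d f) (gMap F Y Z e g)"
    and map_id: "X \<in> gObj C \<Longrightarrow> gMap F X X 0 (gId C X) = gId D (gOn F X)"

definition gr_fun_op :: "('o, 'p, 'm, 'n) gr_fun \<Rightarrow> ('o, 'p, 'm, 'n) gr_fun" where
  "gr_fun_op F = \<lparr>gOn = gOn F, gMap = (\<lambda>X Y. gMap F Y X)\<rparr>"

definition gr_fun_comp ::
  "('o, 'p, 'm, 'n) gr_fun \<Rightarrow> ('p, 'q, 'n, 'l) gr_fun \<Rightarrow> ('o, 'q, 'm, 'l) gr_fun" where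
  "gr_fun_comp F G =
     \<lparr>gOn = (\<lambda>X. gOn G (gOn F X)),
      gMap = (\<lambda>X Y d f. gMap G (gOn F X) (gOn F Y) d (gMap F X Y d f))\<rparr>"

text \<open>Graded-module-valued functors. The representable functor \<open>C(X, -)\<close> sends \<open>g\<close> to
  \<open>z \<mapsto> z g\<close>. On the opposite of \<open>C\<close>, the functor \<open>C(-, Y)\<close> is the covariant representable functor
  of the opposite category, hence sends \<open>f\<close> to \<open>z \<mapsto> (-1)^(deg f deg z) f z\<close>.\<close>

definition gr_hom_from ::
  "('o, 'r, 'm) gr_cat \<Rightarrow> 'o \<Rightarrow> ('o, ('r, 'm) gr_module, 'm, int \<Rightarrow> 'm \<Rightarrow> 'm) gr_fun" where
  "gr_hom_from C X =
     \<lparr>gOn = (\<lambda>Y. gHom C X Y),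
      gMap = (\<lambda>Y Y' n g. \<lambda>d. \<lambda>z\<in>carrier (gHom C X Y d). gComp C X Y Y' d n z g)\<rparr>"

definition gr_hom_into ::
  "('o, 'r, 'm) gr_cat \<Rightarrow> 'o \<Rightarrow> ('o, ('r, 'm) gr_module, 'm, int \<Rightarrow> 'm \<Rightarrow> 'm) gr_fun" where
  "gr_hom_into C Y = gr_hom_from (gr_op C) Y"

text \<open>Duality, as a functor from the opposite of the graded category of graded modules to graded
  modules. It follows the same rule as \<open>C(-, Y)\<close>: an inner hom element \<open>h\<close> of degree \<open>n\<close> from \<open>M\<close> to
  \<open>N\<close> sends \<open>p\<close> to \<open>(-1)^(deg h deg p) h p\<close>. It is defined separately because the unit object and
  \<open>N\<close> have elements of different types.\<close>

definition gr_dual ::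
  "'r ring \<Rightarrow>
   (('r, 'm) gr_module, ('r, int \<Rightarrow> 'm \<Rightarrow> 'r) gr_module,
    int \<Rightarrow> 'm \<Rightarrow> 'm, int \<Rightarrow> (int \<Rightarrow> 'm \<Rightarrow> 'r) \<Rightarrow> int \<Rightarrow> 'm \<Rightarrow> 'r) gr_fun" where
  "gr_dual R =
     \<lparr>gOn = (\<lambda>M. gr_hom R M (gr_unit R)),
      gMap = (\<lambda>N M n h. \<lambda>e. \<lambda>p\<in>carrier (gr_hom R N (gr_unit R) e).
                gr_sgn (gr_hom R M (gr_unit R) (e + n)) (n * e) (gr_comp M n h p))\<rparr>"

text \<open>Enriched naturality of a family of morphisms of degree 0 between two functors with values in
  graded modules: the two composites agree in the inner hom, for morphisms of every degree.\<close>

definition gr_natural ::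
  "'r ring \<Rightarrow> ('o, 'r, 'm) gr_cat \<Rightarrow>
   ('o, ('r, 'a) gr_module, 'm, int \<Rightarrow> 'a \<Rightarrow> 'a) gr_fun \<Rightarrow>
   ('o, ('r, 'b) gr_module, 'm, int \<Rightarrow> 'b \<Rightarrow> 'b) gr_fun \<Rightarrow>
   ('o \<Rightarrow> int \<Rightarrow> 'a \<Rightarrow> 'b) \<Rightarrow> bool" where
  "gr_natural R C F G \<alpha> \<longleftrightarrow>
     (\<forall>X\<in>gObj C. \<alpha> X \<in> carrier (gr_hom R (gOn F X) (gOn G X) 0)) \<and>
     (\<forall>X\<in>gObj C. \<forall>Y\<in>gObj C. \<forall>n. \<forall>f\<in>carrier (gHom C X Y n).
        gr_comp (gOn F X) n (gMap F X Y n f) (\<alpha> Y) = gr_comp (gOn F X) 0 (\<alpha> X) (gMap G X Y n f))"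

definition right_serre_gr_functor ::
  "'r ring \<Rightarrow> ('o, 'r, 'm) gr_cat \<Rightarrow> ('o, 'o, 'm, 'm) gr_fun \<Rightarrow> bool" where
  "right_serre_gr_functor R C S \<longleftrightarrow>
     gr_functor R C C S \<and>
     (\<exists>\<psi>.
        (\<forall>X\<in>gObj C. \<forall>Y\<in>gObj C.
           \<psi> X Y \<in> gr_iso R (gHom C X (gOn S Y)) (gr_hom R (gHom C Y X) (gr_unit R))) \<and>
        (\<forall>Y\<in>gObj C.
           gr_natural R (gr_op C)
             (gr_hom_into C (gOn S Y))
             (gr_fun_comp (gr_fun_op (gr_hom_from C Y)) (gr_dual R))
             (\<lambda>X. \<psi> X Y)) \<and>
        (\<forall>X\<in>gObj C.
           gr_natural R C
             (gr_fun_comp S (gr_hom_from C X))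
             (gr_fun_comp (gr_fun_op (gr_hom_into C X)) (gr_dual R))
             (\<lambda>Y. \<psi> X Y)))"


section \<open>Degree 0 parts and shifts\<close>

definition degree0_cat :: "('o, 'r, 'm) gr_cat \<Rightarrow> ('o, 'r, 'm) k_cat" where
  "degree0_cat C =
     \<lparr>kObj = gObj C,
      kHom = (\<lambda>X Y. gHom C X Y 0),
      kComp = (\<lambda>X Y Z. gComp C X Y Z 0 0),
      kId = gId C\<rparr>"

definition degree0_fun :: "('o, 'p, 'm, 'n) gr_fun \<Rightarrow> ('o, 'p, 'm, 'n) k_fun" where
  "degree0_fun S = \<lparr>kOn = gOn S, kMap = (\<lambda>X Y. gMap S X Y 0)\<rparr>"

text \<open>The category with formal shifts. A morphism of degree \<open>e\<close> from \<open>(Y, m)\<close> to \<open>(Z, p)\<close> is an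
  element \<open>y\<close> of degree \<open>e + (p - m)\<close> of \<open>C(Y, Z)\<close>, and it is this degree of \<open>y\<close> in \<open>C\<close> which
  enters the sign and the composition.\<close>

definition shift_cat :: "('o, 'r, 'm) gr_cat \<Rightarrow> ('o \<times> int, 'r, 'm) gr_cat" where
  "shift_cat C =
     \<lparr>gObj = gObj C \<times> UNIV,
      gHom = (\<lambda>(X, n) (Y, m). gr_shift (gHom C X Y) (m - n)),
      gComp = (\<lambda>(X, n) (Y, m) (Z, p) d e x y.
                 gr_sgn (gr_shift (gHom C X Z) (p - n) (d + e)) ((m - n) * (e + (p - m)))
                   (gComp C X Y Z (d + (m - n)) (e + (p - m)) x y)),
      gId = (\<lambda>(X, n). gId C X)\<rparr>"

text \<open>Isomorphism in a graded category means isomorphism by morphisms of degree 0.\<close>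

definition closed_under_shifts :: "('o, 'r, 'm) gr_cat \<Rightarrow> bool" where
  "closed_under_shifts C \<longleftrightarrow>
     (\<forall>X\<in>gObj C. \<forall>n. \<exists>Y\<in>gObj C. k_isomorphic (degree0_cat (shift_cat C)) (X, n) (Y, 0))"

end

theory Submission
  imports Defs
begin

text \<open>A right Serre functor amounts to traces \<open>tr\<^sub>Y : C(Y, YS)\<^sup>0 \<rightarrow> R\<close>, namely
  \<open>tr\<^sub>Y f = \<psi> f id\<close>, for which the pairing \<open>(g, f) \<mapsto> tr\<^sub>Y (g f)\<close> of \<open>C(Y, X)\<^sup>0\<close> with \<open>C(X, YS)\<^sup>0\<close>
  is perfect. An invertible morphism \<open>X \<rightarrow> X'\<close> of degree \<open>n\<close>, provided by closure under shifts,
  identifies the pairing of \<open>C(Y, X)\<close> in degree \<open>-n\<close> with \<open>C(X, YS)\<close> in degree \<open>n\<close> with the pairing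
  of degree 0 morphisms for \<open>X'\<close>, so it is perfect too. Hence each \<open>h : Y \<rightarrow> Y'\<close> of degree \<open>n\<close> has a
  unique adjoint \<open>k : YS \<rightarrow> Y'S\<close> with \<open>tr (g k) = (-1)^n tr (h g)\<close> for all \<open>g\<close>; uniqueness makes
  \<open>h \<mapsto> k\<close> a graded functor, and in degree 0 the given functor already produces adjoints.\<close>

section \<open>Linear maps and signs\<close>

lemma lin_mapD:
  assumes "lin_map R M N f"
  shows "x \<in> carrier M \<Longrightarrow> f x \<in> carrier N"
    and "\<lbrakk>x \<in> carrier M; y \<in> carrier M\<rbrakk> \<Longrightarrow> f (x \<oplus>\<^bsub>M\<^esub> y) = f x \<oplus>\<^bsub>N\<^esub> f y"
    and "\<lbrakk>a \<in> carrier R; x \<in> carrier M\<rbrakk> \<Longrightarrow> f (a \<odot>\<^bsub>M\<^esub> x) = a \<odot>\<^bsub>N\<^esub> f x"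
  using assms by (auto simp: lin_map_def)

lemma lin_mapI:
  assumes "\<And>x. x \<in> carrier M \<Longrightarrow> f x \<in> carrier N"
    and "\<And>x y. \<lbrakk>x \<in> carrier M; y \<in> carrier M\<rbrakk> \<Longrightarrow> f (x \<oplus>\<^bsub>M\<^esub> y) = f x \<oplus>\<^bsub>N\<^esub> f y"
    and "\<And>a x. \<lbrakk>a \<in> carrier R; x \<in> carrier M\<rbrakk> \<Longrightarrow> f (a \<odot>\<^bsub>M\<^esub> x) = a \<odot>\<^bsub>N\<^esub> f x"
  shows "lin_map R M N f"
  using assms by (auto simp: lin_map_def)

lemma lin_map_compose:
  assumes "lin_map R M N f" "lin_map R N P g"
  shows "lin_map R M P (\<lambda>x. g (f x))"
  using assms by (auto simp: lin_map_def Pi_iff)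

text \<open>Negation becomes a scalar action, so a linear map commutes with signs because it
  commutes with scalars.\<close>

lemma module_minus:
  assumes "module R M" "x \<in> carrier M"
  shows "\<ominus>\<^bsub>M\<^esub> x = (\<ominus>\<^bsub>R\<^esub> \<one>\<^bsub>R\<^esub>) \<odot>\<^bsub>M\<^esub> x"
proof -
  interpret module R M by fact
  show ?thesis using assms(2) by (simp add: smult_l_minus)
qed

lemma module_minus_closed:
  assumes "module R M" "x \<in> carrier M"
  shows "\<ominus>\<^bsub>M\<^esub> x \<in> carrier M"
proof -
  interpret module R M by fact
  show ?thesis using assms(2) by simp
qed

lemma gr_sgn_closed:
  "\<lbrakk>module R M; x \<in> carrier M\<rbrakk> \<Longrightarrow> gr_sgn M k x \<in> carrier M"
  by (simp add: gr_sgn_def module_minus_closed)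

lemma gr_sgn_gr_sgn:
  assumes "module R M" "x \<in> carrier M"
  shows "gr_sgn M k (gr_sgn M l x) = gr_sgn M (k + l) x"
proof -
  interpret module R M by fact
  show ?thesis using assms(2) by (auto simp: gr_sgn_def)
qed

lemma gr_sgn_cong: "even k = even l \<Longrightarrow> gr_sgn M k x = gr_sgn M l x"
  by (simp add: gr_sgn_def)

lemma gr_sgn_linear:
  assumes "module R M"
  shows "lin_map R M M (gr_sgn M k)"
proof -
  interpret module R M by fact
  show ?thesis
    by (auto simp: gr_sgn_def lin_map_def minus_add smult_r_minus)
qed

lemma lin_map_sgn:
  assumes "lin_map R M N f" "module R M" "module R N" "x \<in> carrier M"
  shows "f (gr_sgn M k x) = gr_sgn N k (f x)"
proof -
  interpret module R M by fact
  show ?thesis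
    using assms by (simp add: gr_sgn_def module_minus[of R] lin_mapD)
qed

section \<open>The base ring and the unit object as modules\<close>

lemma module_ring_module:
  assumes "cring R"
  shows "module R (ring_module R)"
proof -
  interpret cring R by fact
  show ?thesis
  proof (rule moduleI)
    show "abelian_group (ring_module R)"
      by (rule abelian_groupI) (auto simp: ring_module_def a_ac intro: bexI[OF _ a_inv_closed] l_neg)
  qed (auto simp: ring_module_def l_distr r_distr m_assoc is_cring)
qed

lemma module_gr_unit:
  assumes "cring R"
  shows "module R (gr_unit R d)"
proof (cases "d = 0")
  case True
  then show ?thesis by (simp add: gr_unit_def module_ring_module assms)
next
  case False
  interpret cring R by fact
  show ?thesis
  proof (rule moduleI)
    show "abelian_group (gr_unit R d)" using False
      by (intro abelian_groupI) (auto simp: gr_unit_def ring_module_def)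
  qed (use False in \<open>auto simp: gr_unit_def ring_module_def is_cring\<close>)
qed

lemma gr_unit_carrier: "d \<noteq> 0 \<Longrightarrow> carrier (gr_unit R d) = {\<zero>\<^bsub>R\<^esub>}"
  by (simp add: gr_unit_def)

section \<open>Negation and signs in the inner hom\<close>

lemma a_inv_gr_hom:
  assumes "\<And>d. module R (M d)" "\<And>d. module R (N d)"
    and p: "p \<in> carrier (gr_hom R M N n)"
  shows "\<ominus>\<^bsub>gr_hom R M N n\<^esub> p = (\<lambda>d. \<lambda>x\<in>carrier (M d). \<ominus>\<^bsub>N (d + n)\<^esub> p d x)" (is "_ = ?q")
proof -
  have p_lin: "lin_map R (M d) (N (d + n)) (p d)" "p d \<in> extensional (carrier (M d))" for d
    using p by (auto simp: gr_hom_def lin_hom_def)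
  have q_lin: "lin_map R (M d) (N (d + n)) (\<lambda>x. \<ominus>\<^bsub>N (d + n)\<^esub> p d x)" for d
    using lin_map_compose[OF p_lin(1) gr_sgn_linear[OF assms(2)], of d 1] by (simp add: gr_sgn_def)
  have q: "?q \<in> carrier (gr_hom R M N n)"
    unfolding gr_hom_def lin_hom_def Let_def
  proof (simp, intro allI)
    fix d
    interpret module R "M d" by (rule assms(1))
    show "lin_map R (M d) (N (d + n)) (\<lambda>x\<in>carrier (M d). \<ominus>\<^bsub>N (d + n)\<^esub> p d x)"
      using q_lin[of d] by (auto simp: lin_map_def)
  qed
  have pq: "p \<oplus>\<^bsub>gr_hom R M N n\<^esub> ?q = \<zero>\<^bsub>gr_hom R M N n\<^esub>"
           "?q \<oplus>\<^bsub>gr_hom R M N n\<^esub> p = \<zero>\<^bsub>gr_hom R M N n\<^esub>"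
  proof -
    have "p d x \<oplus>\<^bsub>N (d + n)\<^esub> \<ominus>\<^bsub>N (d + n)\<^esub> p d x = \<zero>\<^bsub>N (d + n)\<^esub>"
         "\<ominus>\<^bsub>N (d + n)\<^esub> p d x \<oplus>\<^bsub>N (d + n)\<^esub> p d x = \<zero>\<^bsub>N (d + n)\<^esub>"
      if "x \<in> carrier (M d)" for d x
    proof -
      interpret module R "N (d + n)" by (rule assms(2))
      show "p d x \<oplus>\<^bsub>N (d + n)\<^esub> \<ominus>\<^bsub>N (d + n)\<^esub> p d x = \<zero>\<^bsub>N (d + n)\<^esub>"
         "\<ominus>\<^bsub>N (d + n)\<^esub> p d x \<oplus>\<^bsub>N (d + n)\<^esub> p d x = \<zero>\<^bsub>N (d + n)\<^esub>"
        using lin_mapD(1)[OF p_lin(1) that] by (simp_all add: r_neg l_neg)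
    qed
    then show "p \<oplus>\<^bsub>gr_hom R M N n\<^esub> ?q = \<zero>\<^bsub>gr_hom R M N n\<^esub>"
           "?q \<oplus>\<^bsub>gr_hom R M N n\<^esub> p = \<zero>\<^bsub>gr_hom R M N n\<^esub>"
      by (auto simp: gr_hom_def lin_hom_def Let_def fun_eq_iff)
  qed
  have uniq: "q' = ?q" if q': "q' \<in> carrier (gr_hom R M N n)"
    and eq: "p \<oplus>\<^bsub>gr_hom R M N n\<^esub> q' = \<zero>\<^bsub>gr_hom R M N n\<^esub>" for q'
  proof (rule ext)
    fix d
    have q'_lin: "lin_map R (M d) (N (d + n)) (q' d)" "q' d \<in> extensional (carrier (M d))"
      using q' by (auto simp: gr_hom_def lin_hom_def)
    interpret module R "N (d + n)" by (rule assms(2))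
    show "q' d = (\<lambda>x\<in>carrier (M d). \<ominus>\<^bsub>N (d + n)\<^esub> p d x)"
    proof (rule extensionalityI[OF q'_lin(2) restrict_extensional])
      fix x assume x: "x \<in> carrier (M d)"
      have "p d x \<oplus>\<^bsub>N (d + n)\<^esub> q' d x = \<zero>\<^bsub>N (d + n)\<^esub>"
        using fun_cong[OF fun_cong[OF eq, of d], of x] x by (simp add: gr_hom_def lin_hom_def Let_def)
      then have "\<ominus>\<^bsub>N (d + n)\<^esub> p d x = q' d x"
        using lin_mapD(1)[OF p_lin(1) x] lin_mapD(1)[OF q'_lin(1) x]
        by (metis M.minus_equality M.add.m_comm)
      then show "q' d x = (\<lambda>x\<in>carrier (M d). \<ominus>\<^bsub>N (d + n)\<^esub> p d x) x" using x by simp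
    qed
  qed
  \<comment> \<open>No group structure on \<open>gr_hom\<close> is in force here, so negation is
    unfolded to its definite description. The pointwise negative satisfies it, and
    \<open>uniq\<close> shows componentwise that any right inverse equals it.\<close>
  have "\<ominus>\<^bsub>gr_hom R M N n\<^esub> p = (THE y. y \<in> carrier (gr_hom R M N n) \<and>
      p \<oplus>\<^bsub>gr_hom R M N n\<^esub> y = \<zero>\<^bsub>gr_hom R M N n\<^esub> \<and>
      y \<oplus>\<^bsub>gr_hom R M N n\<^esub> p = \<zero>\<^bsub>gr_hom R M N n\<^esub>)"
    by (simp add: a_inv_def m_inv_def)
  also have "\<dots> = ?q"
    using q pq uniq by (intro the_equality) blast+
  finally show ?thesis .
qed

text \<open>The sign in \<open>gr_dual\<close> is taken in the inner hom, while the traces supply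
  signs on values; this moves one to the other. For an even exponent the restriction on the right is
  harmless because members of \<open>lin_hom\<close> are extensional.\<close>

lemma gr_sgn_gr_hom:
  assumes "\<And>d. module R (M d)" "\<And>d. module R (N d)"
    and p: "p \<in> carrier (gr_hom R M N n)"
  shows "gr_sgn (gr_hom R M N n) k p = (\<lambda>d. \<lambda>x\<in>carrier (M d). gr_sgn (N (d + n)) k (p d x))"
proof (cases "even k")
  case True
  have "p d \<in> extensional (carrier (M d))" for d
    using p by (auto simp: gr_hom_def lin_hom_def)
  then show ?thesis using True by (simp add: gr_sgn_def extensional_restrict)
next
  case False
  then show ?thesis using a_inv_gr_hom[OF assms] by (simp add: gr_sgn_def)
qed

section \<open>Membership in hom modules and closure under composition\<close>

lemma lin_hom_carrier_iff:
  "f \<in> carrier (lin_hom R M N) \<longleftrightarrow> f \<in> extensional (carrier M) \<and> lin_map R M N f"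
  by (simp add: lin_hom_def)

lemma restrict_lin_hom:
  assumes "module R M"  "lin_map R M N f"
  shows "(\<lambda>x\<in>carrier M. f x) \<in> carrier (lin_hom R M N)"
proof -
  interpret module R M by fact
  show ?thesis using assms(2) by (auto simp: lin_hom_carrier_iff lin_map_def)
qed

lemma gr_hom_carrier_iff:
  "f \<in> carrier (gr_hom R M N n) \<longleftrightarrow> (\<forall>d. f d \<in> carrier (lin_hom R (M d) (N (d + n))))"
  by (simp add: gr_hom_def)

lemma gr_comp_closed:
  assumes "\<And>d. module R (M d)" "f \<in> carrier (gr_hom R M N n)" "g \<in> carrier (gr_hom R N P e)"
  shows "gr_comp M n f g \<in> carrier (gr_hom R M P (e + n))"
  unfolding gr_hom_carrier_iff gr_comp_def
proof (intro allI restrict_lin_hom assms(1))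
  fix d
  have "lin_map R (N (d + n)) (P (d + n + e)) (g (d + n))" "lin_map R (M d) (N (d + n)) (f d)"
    using assms(2,3) by (auto simp: gr_hom_carrier_iff lin_hom_carrier_iff)
  from lin_map_compose[OF this(2,1)]
  show "lin_map R (M d) (P (d + (e + n))) (\<lambda>x. g (d + n) (f d x))"
    by (simp add: ac_simps)
qed


section \<open>Invertible shifts\<close>

context gr_category
begin

abbreviation Hom where
  "Hom X Y d \<equiv> carrier (gHom C X Y d)"

lemma comp_closed:
  assumes "X \<in> gObj C" "Y \<in> gObj C" "Z \<in> gObj C" "f \<in> Hom X Y d" "g \<in> Hom Y Z e" "k = d + e"
  shows "gComp C X Y Z d e f g \<in> Hom X Z k"
  using lin_mapD(1)[OF comp_linear_right[OF assms(1-4)] assms(5)] assms(6) by simp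

text \<open>The degrees of the inner composites are free variables tied by equations, so that a sum
  such as \<open>n + - n\<close> can be entered directly as \<open>0\<close>.\<close>

lemma comp_assoc_deg:
  assumes "X \<in> gObj C" "Y \<in> gObj C" "Z \<in> gObj C" "W \<in> gObj C"
    and "f \<in> Hom X Y d" "g \<in> Hom Y Z e" "h \<in> Hom Z W l" and "k = d + e" "m = e + l"
  shows "gComp C X Z W k l (gComp C X Y Z d e f g) h = gComp C X Y W d m f (gComp C Y Z W e l g h)"
  using comp_assoc[OF assms(1-7)] assms(8,9) by simp

lemma comp_sgn_right:
  assumes "X \<in> gObj C" "Y \<in> gObj C" "Z \<in> gObj C" "f \<in> Hom X Y d" "g \<in> Hom Y Z e"
  shows "gComp C X Y Z d e f (gr_sgn (gHom C Y Z e) k g)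
    = gr_sgn (gHom C X Z (d + e)) k (gComp C X Y Z d e f g)"
  by (rule lin_map_sgn[OF comp_linear_right]) (use assms in \<open>simp_all add: hom_module\<close>)

lemma comp_sgn_left:
  assumes "X \<in> gObj C" "Y \<in> gObj C" "Z \<in> gObj C" "f \<in> Hom X Y d" "g \<in> Hom Y Z e"
  shows "gComp C X Y Z d e (gr_sgn (gHom C X Y d) k f) g
    = gr_sgn (gHom C X Z (d + e)) k (gComp C X Y Z d e f g)"
  by (rule lin_map_sgn[OF comp_linear_left]) (use assms in \<open>simp_all add: hom_module\<close>)

text \<open>Closure under shifts, read back in \<open>C\<close>: a degree 0 isomorphism of formally
  shifted objects is an invertible morphism of nonzero degree, up to the Koszul sign in the
  composition of \<open>shift_cat\<close>.\<close>

lemma closed_under_shifts_iso: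
  assumes "closed_under_shifts C" and X: "X \<in> gObj C"
  obtains X' u v where "X' \<in> gObj C" "u \<in> Hom X X' n" "v \<in> Hom X' X (- n)"
    and "gComp C X X' X n (- n) u v = gId C X" "gComp C X' X X' (- n) n v u = gId C X'"
proof -
  \<comment> \<open>The shift by \<open>- n\<close> is chosen because degree 0 morphisms from
    \<open>(X, - n)\<close> to \<open>(X', 0)\<close> are the elements of \<open>C(X, X')\<close> of
    degree \<open>0 - (- n) = n\<close>.\<close>
  obtain X' where "k_isomorphic (degree0_cat (shift_cat C)) (X, - n) (X', 0)"
    using assms unfolding closed_under_shifts_def by blast
  then obtain u v where X': "X' \<in> gObj C" and u: "u \<in> Hom X X' n" and v: "v \<in> Hom X' X (- n)"
    and uv: "gr_sgn (gHom C X X 0) (n * - n) (gComp C X X' X n (- n) u v) = gId C X"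
    and vu: "gr_sgn (gHom C X' X' 0) (- n * n) (gComp C X' X X' (- n) n v u) = gId C X'"
    by (auto simp: k_isomorphic_def degree0_cat_def shift_cat_def gr_shift_def)
  \<comment> \<open>Both composites carry the same sign, with exponent \<open>n * - n\<close>, so
    absorbing it into \<open>v\<close> makes \<open>u\<close> and the new \<open>v\<close> strictly
    inverse on both sides.\<close>
  let ?v = "gr_sgn (gHom C X' X (- n)) (n * - n) v"
  show ?thesis
  proof (rule that[OF X' u])
    show "?v \<in> Hom X' X (- n)"
      by (rule gr_sgn_closed[OF hom_module[OF X' X] v])
    show "gComp C X X' X n (- n) u ?v = gId C X"
      using comp_sgn_right[OF X X' X u v] uv by simp
    show "gComp C X' X X' (- n) n ?v u = gId C X'"
      using comp_sgn_left[OF X' X X' v u] vu by simp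
  qed
qed

end

section \<open>Perfect pairings given by traces\<close>

text \<open>The last two assumptions are injectivity and surjectivity of the map sending
  \<open>f\<close> to the functional \<open>g \<mapsto> tr (g f)\<close>, from
  \<open>C(X, YS)\<close> to the dual of \<open>C(Y, X)\<close> in degree 0. \<open>S\<close> is a
  map on objects alone; its action on morphisms of every degree is recovered from the
  traces.\<close>

locale graded_trace = gr_category R C
  for R :: "'r ring" and C :: "('o, 'r, 'm) gr_cat" +
  fixes S :: "'o \<Rightarrow> 'o" and tr :: "'o \<Rightarrow> 'm \<Rightarrow> 'r"
  assumes shifts: "closed_under_shifts C"
    and S_obj: "Y \<in> gObj C \<Longrightarrow> S Y \<in> gObj C"
    and tr_linear: "Y \<in> gObj C \<Longrightarrow> lin_map R (gHom C Y (S Y) 0) (ring_module R) (tr Y)"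
    and nondegenerate0:
      "\<lbrakk>X \<in> gObj C; Y \<in> gObj C; f \<in> Hom X (S Y) 0; f' \<in> Hom X (S Y) 0;
        \<And>g. g \<in> Hom Y X 0 \<Longrightarrow>
          tr Y (gComp C Y X (S Y) 0 0 g f) = tr Y (gComp C Y X (S Y) 0 0 g f')\<rbrakk> \<Longrightarrow> f = f'"
    and represent0:
      "\<lbrakk>X \<in> gObj C; Y \<in> gObj C; lin_map R (gHom C Y X 0) (ring_module R) \<phi>\<rbrakk> \<Longrightarrow>
        \<exists>f\<in>Hom X (S Y) 0. \<forall>g\<in>Hom Y X 0. tr Y (gComp C Y X (S Y) 0 0 g f) = \<phi> g"
begin

text \<open>Composing with \<open>v : X' \<rightarrow> X\<close> of degree \<open>- n\<close> brings
  \<open>f\<close> into degree 0. Since \<open>g (v f) = (g v) f\<close>, the degree 0 tests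
  \<open>g\<close> become tests \<open>g v\<close> of degree \<open>- n\<close>, where the
  hypothesis applies; composing with \<open>u\<close> then cancels \<open>v\<close>.\<close>

lemma nondegenerate:
  assumes X: "X \<in> gObj C" and Y: "Y \<in> gObj C"
    and f: "f \<in> Hom X (S Y) n" and f': "f' \<in> Hom X (S Y) n"
    and eq: "\<And>g. g \<in> Hom Y X (- n) \<Longrightarrow>
      tr Y (gComp C Y X (S Y) (- n) n g f) = tr Y (gComp C Y X (S Y) (- n) n g f')"
  shows "f = f'"
proof -
  note SY = S_obj[OF Y]
  obtain X' u v where X': "X' \<in> gObj C" and u: "u \<in> Hom X X' n" and v: "v \<in> Hom X' X (- n)"
    and uv: "gComp C X X' X n (- n) u v = gId C X"
    using closed_under_shifts_iso[OF shifts X] by blast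
  have cancel: "gComp C X X' (S Y) n 0 u (gComp C X' X (S Y) (- n) n v h) = h"
    if "h \<in> Hom X (S Y) n" for h
    using comp_assoc_deg[OF X X' X SY u v that, of 0 0] uv id_left[OF X SY that] by simp
  have "gComp C X' X (S Y) (- n) n v f = gComp C X' X (S Y) (- n) n v f'"
  proof (rule nondegenerate0[OF X' Y])
    show "gComp C X' X (S Y) (- n) n v f \<in> Hom X' (S Y) 0"
      by (rule comp_closed[OF X' X SY v f]) simp
    show "gComp C X' X (S Y) (- n) n v f' \<in> Hom X' (S Y) 0"
      by (rule comp_closed[OF X' X SY v f']) simp
    fix g assume g: "g \<in> Hom Y X' 0"
    have gv: "gComp C Y X' X 0 (- n) g v \<in> Hom Y X (- n)"
      by (rule comp_closed[OF Y X' X g v]) simp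
    have "gComp C Y X' (S Y) 0 0 g (gComp C X' X (S Y) (- n) n v h)
        = gComp C Y X (S Y) (- n) n (gComp C Y X' X 0 (- n) g v) h" if "h \<in> Hom X (S Y) n" for h
      using comp_assoc_deg[OF Y X' X SY g v that, of "- n" 0] by simp
    then show "tr Y (gComp C Y X' (S Y) 0 0 g (gComp C X' X (S Y) (- n) n v f)) =
        tr Y (gComp C Y X' (S Y) 0 0 g (gComp C X' X (S Y) (- n) n v f'))"
      using eq[OF gv] f f' by simp
  qed
  then show ?thesis using cancel[OF f] cancel[OF f'] by metis
qed

text \<open>The functional \<open>g \<mapsto> \<phi> (g v)\<close> on degree 0 morphisms is
  represented by some \<open>f0\<close>, and \<open>u f0\<close> represents \<open>\<phi>\<close>:
  one has \<open>g (u f0) = (g u) f0\<close> and \<open>(g u) v = g\<close>.\<close>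

lemma represent:
  assumes X: "X \<in> gObj C" and Y: "Y \<in> gObj C"
    and \<phi>: "lin_map R (gHom C Y X (- n)) (ring_module R) \<phi>"
  shows "\<exists>f\<in>Hom X (S Y) n. \<forall>g\<in>Hom Y X (- n). tr Y (gComp C Y X (S Y) (- n) n g f) = \<phi> g"
proof -
  note SY = S_obj[OF Y]
  obtain X' u v where X': "X' \<in> gObj C" and u: "u \<in> Hom X X' n" and v: "v \<in> Hom X' X (- n)"
    and uv: "gComp C X X' X n (- n) u v = gId C X"
    using closed_under_shifts_iso[OF shifts X] by blast
  have "lin_map R (gHom C Y X' 0) (gHom C Y X (- n)) (\<lambda>g. gComp C Y X' X 0 (- n) g v)"
    using comp_linear_left[OF Y X' X v, of 0] by simp
  from represent0[OF X' Y lin_map_compose[OF this \<phi>]]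
  obtain f0 where f0: "f0 \<in> Hom X' (S Y) 0"
    and rep: "\<And>g. g \<in> Hom Y X' 0 \<Longrightarrow>
      tr Y (gComp C Y X' (S Y) 0 0 g f0) = \<phi> (gComp C Y X' X 0 (- n) g v)"
    by blast
  show ?thesis
  proof (intro bexI ballI)
    show "gComp C X X' (S Y) n 0 u f0 \<in> Hom X (S Y) n"
      by (rule comp_closed[OF X X' SY u f0]) simp
    fix g assume g: "g \<in> Hom Y X (- n)"
    have gu: "gComp C Y X X' (- n) n g u \<in> Hom Y X' 0"
      by (rule comp_closed[OF Y X X' g u]) simp
    have "gComp C Y X (S Y) (- n) n g (gComp C X X' (S Y) n 0 u f0)
        = gComp C Y X' (S Y) 0 0 (gComp C Y X X' (- n) n g u) f0"
      using comp_assoc_deg[OF Y X X' SY g u f0, of 0 n] by simp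
    moreover have "gComp C Y X' X 0 (- n) (gComp C Y X X' (- n) n g u) v = g"
      using comp_assoc_deg[OF Y X X' X g u v, of 0 0] uv id_right[OF Y X g] by simp
    ultimately show "tr Y (gComp C Y X (S Y) (- n) n g (gComp C X X' (S Y) n 0 u f0)) = \<phi> g"
      using rep[OF gu] by simp
  qed
qed

text \<open>The sign is forced: naturality of \<open>f \<mapsto> (g \<mapsto> tr (g f))\<close> in the second variable requires
  \<open>tr (x z k) = (-1)^(n e + n d) tr (h x z)\<close> for \<open>x\<close>, \<open>z\<close> of degrees \<open>d\<close>, \<open>e\<close> with \<open>d + e + n = 0\<close>,
  where \<open>n e\<close> comes from duality and \<open>n d\<close> from the opposite category.\<close>

definition adjoint_map :: "'o \<Rightarrow> 'o \<Rightarrow> int \<Rightarrow> 'm \<Rightarrow> 'm \<Rightarrow> bool" where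
  "adjoint_map Y Y' n h k \<longleftrightarrow>
     k \<in> Hom (S Y) (S Y') n \<and>
     (\<forall>g\<in>Hom Y' (S Y) (- n).
        tr Y' (gComp C Y' (S Y) (S Y') (- n) n g k)
        = gr_sgn (ring_module R) n (tr Y (gComp C Y Y' (S Y) n (- n) h g)))"

text \<open>The defining identity prescribes the trace of \<open>g k\<close> for every
  \<open>g\<close> from \<open>Y'\<close> to \<open>S Y\<close> of degree \<open>- n\<close>, which
  are exactly the tests in \<open>nondegenerate\<close> with source \<open>S Y\<close>.\<close>

lemma adjoint_map_unique:
  assumes "Y \<in> gObj C" "Y' \<in> gObj C" "adjoint_map Y Y' n h k" "adjoint_map Y Y' n h k'"
  shows "k = k'"
  by (rule nondegenerate[of "S Y" Y' _ n]) (use assms in \<open>auto simp: adjoint_map_def S_obj\<close>)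

text \<open>The signed trace of \<open>h g\<close> is linear in \<open>g\<close>, hence represented
  by some \<open>k\<close> out of \<open>S Y\<close>.\<close>

lemma adjoint_map_exists:
  assumes Y: "Y \<in> gObj C" and Y': "Y' \<in> gObj C" and h: "h \<in> Hom Y Y' n"
  shows "\<exists>k. adjoint_map Y Y' n h k"
proof -
  have "lin_map R (gHom C Y' (S Y) (- n)) (gHom C Y (S Y) 0) (\<lambda>g. gComp C Y Y' (S Y) n (- n) h g)"
    using comp_linear_right[OF Y Y' S_obj[OF Y] h, of "- n"] by simp
  from lin_map_compose[OF lin_map_compose[OF this tr_linear[OF Y]]
      gr_sgn_linear[OF module_ring_module[OF base_ring], of n]]
  show ?thesis
    using represent[OF S_obj[OF Y] Y'] unfolding adjoint_map_def by blast
qed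

text \<open>The defining identity for the test morphism \<open>x z\<close>, of degree
  \<open>d + e = - n\<close>, rebracketed on both sides. Functoriality and naturality both use
  adjoints in this form.\<close>

lemma adjoint_map_trace:
  assumes X: "X \<in> gObj C" and Y: "Y \<in> gObj C" and Y': "Y' \<in> gObj C"
    and h: "h \<in> Hom Y Y' n" and x: "x \<in> Hom Y' X d" and z: "z \<in> Hom X (S Y) e"
    and deg: "d + e + n = 0" and k: "adjoint_map Y Y' n h k"
  shows "tr Y' (gComp C Y' X (S Y') d (e + n) x (gComp C X (S Y) (S Y') e n z k))
    = gr_sgn (ring_module R) n (tr Y (gComp C Y X (S Y) (n + d) e (gComp C Y Y' X n d h x) z))"
proof -
  note SY = S_obj[OF Y] and SY' = S_obj[OF Y']
  have [simp]: "d + e = - n" using deg by simp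
  have k_hom: "k \<in> Hom (S Y) (S Y') n" using k by (simp add: adjoint_map_def)
  have "gComp C Y' X (S Y) d e x z \<in> Hom Y' (S Y) (- n)"
    by (rule comp_closed[OF Y' X SY x z]) simp
  then show ?thesis
    using k comp_assoc[OF Y' X SY SY' x z k_hom, symmetric] comp_assoc[OF Y Y' X SY h x z]
    by (simp add: adjoint_map_def)
qed

section \<open>Functoriality of adjoints\<close>

lemma adjoint_map_add:
  assumes Y: "Y \<in> gObj C" and Y': "Y' \<in> gObj C"
    and h: "h \<in> Hom Y Y' n" "h' \<in> Hom Y Y' n"
    and k: "adjoint_map Y Y' n h k" "adjoint_map Y Y' n h' k'"
  shows "adjoint_map Y Y' n (h \<oplus>\<^bsub>gHom C Y Y' n\<^esub> h') (k \<oplus>\<^bsub>gHom C (S Y) (S Y') n\<^esub> k')"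
  unfolding adjoint_map_def
proof (intro conjI ballI)
  note SY = S_obj[OF Y] and SY' = S_obj[OF Y']
  have k_hom: "k \<in> Hom (S Y) (S Y') n" "k' \<in> Hom (S Y) (S Y') n"
    using k by (simp_all add: adjoint_map_def)
  interpret K: module R "gHom C (S Y) (S Y') n" by (rule hom_module[OF SY SY'])
  show "k \<oplus>\<^bsub>gHom C (S Y) (S Y') n\<^esub> k' \<in> Hom (S Y) (S Y') n"
    using k_hom by simp
  fix g assume g: "g \<in> Hom Y' (S Y) (- n)"
  have gk: "gComp C Y' (S Y) (S Y') (- n) n g l \<in> Hom Y' (S Y') 0" if "l \<in> Hom (S Y) (S Y') n" for l
    by (rule comp_closed[OF Y' SY SY' g that]) simp
  have hg: "gComp C Y Y' (S Y) n (- n) l g \<in> Hom Y (S Y) 0" if "l \<in> Hom Y Y' n" for l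
    by (rule comp_closed[OF Y Y' SY that g]) simp
  show "tr Y' (gComp C Y' (S Y) (S Y') (- n) n g (k \<oplus>\<^bsub>gHom C (S Y) (S Y') n\<^esub> k'))
      = gr_sgn (ring_module R) n
          (tr Y (gComp C Y Y' (S Y) n (- n) (h \<oplus>\<^bsub>gHom C Y Y' n\<^esub> h') g))"
    using k g lin_mapD(2)[OF comp_linear_right[OF Y' SY SY' g] k_hom]
      lin_mapD(2)[OF comp_linear_left[OF Y Y' SY g] h]
    by (simp add: adjoint_map_def gk hg k_hom h lin_mapD[OF tr_linear] Y Y'
        lin_mapD[OF gr_sgn_linear[OF module_ring_module[OF base_ring]]])
qed

lemma adjoint_map_smult:
  assumes Y: "Y \<in> gObj C" and Y': "Y' \<in> gObj C" and a: "a \<in> carrier R"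
    and h: "h \<in> Hom Y Y' n" and k: "adjoint_map Y Y' n h k"
  shows "adjoint_map Y Y' n (a \<odot>\<^bsub>gHom C Y Y' n\<^esub> h) (a \<odot>\<^bsub>gHom C (S Y) (S Y') n\<^esub> k)"
  unfolding adjoint_map_def
proof (intro conjI ballI)
  note SY = S_obj[OF Y] and SY' = S_obj[OF Y']
  have k_hom: "k \<in> Hom (S Y) (S Y') n"
    using k by (simp_all add: adjoint_map_def)
  interpret K: module R "gHom C (S Y) (S Y') n" by (rule hom_module[OF SY SY'])
  show "a \<odot>\<^bsub>gHom C (S Y) (S Y') n\<^esub> k \<in> Hom (S Y) (S Y') n"
    using k_hom a by simp
  fix g assume g: "g \<in> Hom Y' (S Y) (- n)"
  have gk: "gComp C Y' (S Y) (S Y') (- n) n g k \<in> Hom Y' (S Y') 0"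
    by (rule comp_closed[OF Y' SY SY' g k_hom]) simp
  have hg: "gComp C Y Y' (S Y) n (- n) h g \<in> Hom Y (S Y) 0"
    by (rule comp_closed[OF Y Y' SY h g]) simp
  show "tr Y' (gComp C Y' (S Y) (S Y') (- n) n g (a \<odot>\<^bsub>gHom C (S Y) (S Y') n\<^esub> k))
      = gr_sgn (ring_module R) n
          (tr Y (gComp C Y Y' (S Y) n (- n) (a \<odot>\<^bsub>gHom C Y Y' n\<^esub> h) g))"
    using k g lin_mapD(3)[OF comp_linear_right[OF Y' SY SY' g] a k_hom]
      lin_mapD(3)[OF comp_linear_left[OF Y Y' SY g] a h]
    by (simp add: adjoint_map_def gk hg lin_mapD[OF tr_linear] Y Y' a
        lin_mapD[OF gr_sgn_linear[OF module_ring_module[OF base_ring]]])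
qed

lemma adjoint_map_id:
  assumes Y: "Y \<in> gObj C"
  shows "adjoint_map Y Y 0 (gId C Y) (gId C (S Y))"
  using Y S_obj[OF Y] by (auto simp: adjoint_map_def id_closed id_left id_right gr_sgn_def)

text \<open>Two moves around the trace: \<open>k'\<close> leaves \<open>g k k'\<close> at the cost
  of \<open>(-1)^m\<close>, giving the trace of \<open>h' g k\<close>, and then \<open>k\<close>
  leaves at the cost of \<open>(-1)^n\<close>, giving the trace of \<open>h h' g\<close>. The
  exponents add up to the sign required in degree \<open>n + m\<close>.\<close>

lemma adjoint_map_comp:
  assumes Y: "Y \<in> gObj C" and Y': "Y' \<in> gObj C" and Z: "Z \<in> gObj C"
    and h: "h \<in> Hom Y Y' n" and h': "h' \<in> Hom Y' Z m"
    and k: "adjoint_map Y Y' n h k" and k': "adjoint_map Y' Z m h' k'"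
  shows "adjoint_map Y Z (n + m) (gComp C Y Y' Z n m h h') (gComp C (S Y) (S Y') (S Z) n m k k')"
  unfolding adjoint_map_def
proof (intro conjI ballI)
  note SY = S_obj[OF Y] and SY' = S_obj[OF Y'] and SZ = S_obj[OF Z]
  have k_hom: "k \<in> Hom (S Y) (S Y') n" "k' \<in> Hom (S Y') (S Z) m"
    using k k' by (simp_all add: adjoint_map_def)
  show "gComp C (S Y) (S Y') (S Z) n m k k' \<in> Hom (S Y) (S Z) (n + m)"
    by (rule comp_closed[OF SY SY' SZ k_hom]) simp
  fix g assume g: "g \<in> Hom Z (S Y) (- (n + m))"
  have h'g: "gComp C Y' Z (S Y) m (- (n + m)) h' g \<in> Hom Y' (S Y) (- n)"
    by (rule comp_closed[OF Y' Z SY h' g]) simp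
  have "gComp C Y Y' (S Y) n (- n) h (gComp C Y' Z (S Y) m (- (n + m)) h' g) \<in> Hom Y (S Y) 0"
    by (rule comp_closed[OF Y Y' SY h h'g]) simp
  then have carr: "tr Y (gComp C Y Y' (S Y) n (- n) h (gComp C Y' Z (S Y) m (- (n + m)) h' g))
      \<in> carrier (ring_module R)"
    by (rule lin_mapD(1)[OF tr_linear[OF Y]])
  have "tr Z (gComp C Z (S Y) (S Z) (- (n + m)) (n + m) g (gComp C (S Y) (S Y') (S Z) n m k k'))
      = gr_sgn (ring_module R) m
          (tr Y' (gComp C Y' (S Y) (S Y') (- n) n (gComp C Y' Z (S Y) m (- (n + m)) h' g) k))"
    using adjoint_map_trace[OF SY Y' Z h' g k_hom(1) _ k'] by simp
  also have "\<dots> = gr_sgn (ring_module R) (n + m)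
      (tr Y (gComp C Y Y' (S Y) n (- n) h (gComp C Y' Z (S Y) m (- (n + m)) h' g)))"
    using k h'g gr_sgn_gr_sgn[OF module_ring_module[OF base_ring] carr, of m n]
    by (simp add: adjoint_map_def add.commute)
  also have "gComp C Y Y' (S Y) n (- n) h (gComp C Y' Z (S Y) m (- (n + m)) h' g)
      = gComp C Y Z (S Y) (n + m) (- (n + m)) (gComp C Y Y' Z n m h h') g"
    using comp_assoc_deg[OF Y Y' Z SY h h' g, of "n + m" "- n"] by simp
  finally show "tr Z (gComp C Z (S Y) (S Z) (- (n + m)) (n + m) g
        (gComp C (S Y) (S Y') (S Z) n m k k'))
      = gr_sgn (ring_module R) (n + m)
          (tr Y (gComp C Y Z (S Y) (n + m) (- (n + m)) (gComp C Y Y' Z n m h h') g))" .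
qed

text \<open>Each functor law equates two adjoints of one morphism, so it follows from uniqueness.
  \<open>F\<close> is any choice of adjoints, which leaves room to prescribe its degree 0
  part.\<close>

lemma adjoint_map_gr_functor:
  assumes on: "gOn F = S"
    and adj: "\<And>Y Y' n h. \<lbrakk>Y \<in> gObj C; Y' \<in> gObj C; h \<in> Hom Y Y' n\<rbrakk>
      \<Longrightarrow> adjoint_map Y Y' n h (gMap F Y Y' n h)"
  shows "gr_functor R C C F"
proof
  show "gOn F X \<in> gObj C" if "X \<in> gObj C" for X
    using that by (simp add: on S_obj)
  show "lin_map R (gHom C X Y d) (gHom C (gOn F X) (gOn F Y) d) (gMap F X Y d)"
    if X: "X \<in> gObj C" and Y: "Y \<in> gObj C" for X Y d
  proof (rule lin_mapI, unfold on)
    interpret module R "gHom C X Y d" by (rule hom_module[OF X Y])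
    show "gMap F X Y d x \<in> Hom (S X) (S Y) d" if "x \<in> Hom X Y d" for x
      using adj[OF X Y that] by (simp add: adjoint_map_def)
    show "gMap F X Y d (x \<oplus>\<^bsub>gHom C X Y d\<^esub> y)
        = gMap F X Y d x \<oplus>\<^bsub>gHom C (S X) (S Y) d\<^esub> gMap F X Y d y"
      if "x \<in> Hom X Y d" "y \<in> Hom X Y d" for x y
      by (rule adjoint_map_unique[OF X Y adj[OF X Y] adjoint_map_add[OF X Y]])
        (use that in \<open>simp_all add: adj[OF X Y]\<close>)
    show "gMap F X Y d (a \<odot>\<^bsub>gHom C X Y d\<^esub> x) = a \<odot>\<^bsub>gHom C (S X) (S Y) d\<^esub> gMap F X Y d x"
      if "a \<in> carrier R" "x \<in> Hom X Y d" for a x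
      by (rule adjoint_map_unique[OF X Y adj[OF X Y] adjoint_map_smult[OF X Y]])
        (use that in \<open>simp_all add: adj[OF X Y]\<close>)
  qed
  show "gMap F X Z (d + e) (gComp C X Y Z d e f g)
      = gComp C (gOn F X) (gOn F Y) (gOn F Z) d e (gMap F X Y d f) (gMap F Y Z e g)"
    if X: "X \<in> gObj C" and Y: "Y \<in> gObj C" and Z: "Z \<in> gObj C"
      and f: "f \<in> Hom X Y d" and g: "g \<in> Hom Y Z e" for X Y Z f d g e
    unfolding on
    by (rule adjoint_map_unique[OF X Z adj[OF X Z comp_closed[OF X Y Z f g refl]]
          adjoint_map_comp[OF X Y Z f g adj[OF X Y f] adj[OF Y Z g]]])
  show "gMap F X X 0 (gId C X) = gId C (gOn F X)" if X: "X \<in> gObj C" for X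
    unfolding on
    by (rule adjoint_map_unique[OF X X adj[OF X X id_closed[OF X]] adjoint_map_id[OF X]])
qed

section \<open>The isomorphism with the graded dual\<close>

definition trace_iso :: "'o \<Rightarrow> 'o \<Rightarrow> int \<Rightarrow> 'm \<Rightarrow> int \<Rightarrow> 'm \<Rightarrow> 'r" where
  "trace_iso X Y n = (\<lambda>f\<in>Hom X (S Y) n. \<lambda>d. \<lambda>g\<in>Hom Y X d.
     if d + n = 0 then tr Y (gComp C Y X (S Y) d n g f) else \<zero>\<^bsub>R\<^esub>)"

text \<open>The degree condition is an equation, so the lemma fits sums such as \<open>e + n\<close>
  and \<open>d\<close> without rewriting either to the negative of the other.\<close>

lemma trace_comp_linear:
  assumes X: "X \<in> gObj C" and Y: "Y \<in> gObj C" and "d + n = 0"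
  shows "f \<in> Hom X (S Y) n \<Longrightarrow>
      lin_map R (gHom C Y X d) (ring_module R) (\<lambda>g. tr Y (gComp C Y X (S Y) d n g f))"
    and "g \<in> Hom Y X d \<Longrightarrow>
      lin_map R (gHom C X (S Y) n) (ring_module R) (\<lambda>f. tr Y (gComp C Y X (S Y) d n g f))"
  using lin_map_compose[OF comp_linear_left[OF Y X S_obj[OF Y], of f n d], of "ring_module R" "tr Y"]
    lin_map_compose[OF comp_linear_right[OF Y X S_obj[OF Y], of g d n], of "ring_module R" "tr Y"]
    tr_linear[OF Y] assms(3)
  by simp_all

text \<open>A family of degree \<open>n\<close> with values in the unit object has a component in
  each degree \<open>d\<close>, but the target vanishes unless \<open>d + n = 0\<close>. Hence the
  trace pairing gives the one component that matters and zero is the only choice elsewhere.\<close>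

lemma trace_iso_closed:
  assumes X: "X \<in> gObj C" and Y: "Y \<in> gObj C" and f: "f \<in> Hom X (S Y) n"
  shows "trace_iso X Y n f \<in> carrier (gr_hom R (gHom C Y X) (gr_unit R) n)"
  unfolding gr_hom_carrier_iff
proof
  fix d
  interpret R: cring R by (rule base_ring)
  have "lin_map R (gHom C Y X d) (gr_unit R (d + n))
      (\<lambda>g. if d + n = 0 then tr Y (gComp C Y X (S Y) d n g f) else \<zero>\<^bsub>R\<^esub>)"
  proof (cases "d + n = 0")
    case True
    then show ?thesis using trace_comp_linear(1)[OF X Y True f] by (simp add: gr_unit_def)
  next
    case False
    then show ?thesis by (auto simp: lin_map_def gr_unit_def ring_module_def)
  qed
  from restrict_lin_hom[OF hom_module[OF Y X] this]
  show "trace_iso X Y n f d \<in> carrier (lin_hom R (gHom C Y X d) (gr_unit R (d + n)))"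
    using f by (simp add: trace_iso_def)
qed

lemma trace_iso_linear:
  assumes X: "X \<in> gObj C" and Y: "Y \<in> gObj C"
  shows "lin_map R (gHom C X (S Y) n) (gr_hom R (gHom C Y X) (gr_unit R) n) (trace_iso X Y n)"
proof (rule lin_mapI)
  interpret R: cring R by (rule base_ring)
  interpret M: module R "gHom C X (S Y) n" by (rule hom_module[OF X S_obj[OF Y]])
  show "trace_iso X Y n f \<in> carrier (gr_hom R (gHom C Y X) (gr_unit R) n)"
    if "f \<in> Hom X (S Y) n" for f
    by (rule trace_iso_closed[OF X Y that])
  show "trace_iso X Y n (f \<oplus>\<^bsub>gHom C X (S Y) n\<^esub> f')
      = trace_iso X Y n f \<oplus>\<^bsub>gr_hom R (gHom C Y X) (gr_unit R) n\<^esub> trace_iso X Y n f'"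
    if "f \<in> Hom X (S Y) n" "f' \<in> Hom X (S Y) n" for f f'
    using that lin_mapD(2)[OF trace_comp_linear(2)[OF X Y]]
    by (auto simp: fun_eq_iff trace_iso_def gr_hom_def lin_hom_def Let_def gr_unit_def ring_module_def)
  show "trace_iso X Y n (a \<odot>\<^bsub>gHom C X (S Y) n\<^esub> f)
      = a \<odot>\<^bsub>gr_hom R (gHom C Y X) (gr_unit R) n\<^esub> trace_iso X Y n f"
    if "a \<in> carrier R" "f \<in> Hom X (S Y) n" for a f
    using that lin_mapD(3)[OF trace_comp_linear(2)[OF X Y]]
    by (auto simp: fun_eq_iff trace_iso_def gr_hom_def lin_hom_def Let_def gr_unit_def ring_module_def)
qed

text \<open>An element of the dual is determined by its component in degree \<open>- n\<close>:
  injectivity is nondegeneracy tested there, and surjectivity represents the functional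
  \<open>p (- n)\<close>, the other components being forced to vanish.\<close>

lemma trace_iso_bij:
  assumes X: "X \<in> gObj C" and Y: "Y \<in> gObj C"
  shows "bij_betw (trace_iso X Y n) (Hom X (S Y) n)
    (carrier (gr_hom R (gHom C Y X) (gr_unit R) n))"
proof (rule bij_betwI')
  show "trace_iso X Y n f = trace_iso X Y n f' \<longleftrightarrow> f = f'"
    if f: "f \<in> Hom X (S Y) n" and f': "f' \<in> Hom X (S Y) n" for f f'
  proof
    assume eq: "trace_iso X Y n f = trace_iso X Y n f'"
    show "f = f'"
    proof (rule nondegenerate[OF X Y f f'])
      fix g assume "g \<in> Hom Y X (- n)"
      then show "tr Y (gComp C Y X (S Y) (- n) n g f) = tr Y (gComp C Y X (S Y) (- n) n g f')"
        using fun_cong[OF fun_cong[OF eq, of "- n"], of g] f f' by (simp add: trace_iso_def)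
    qed
  qed simp
  show "trace_iso X Y n f \<in> carrier (gr_hom R (gHom C Y X) (gr_unit R) n)"
    if "f \<in> Hom X (S Y) n" for f
    by (rule trace_iso_closed[OF X Y that])
  fix p assume p: "p \<in> carrier (gr_hom R (gHom C Y X) (gr_unit R) n)"
  then have p_lin: "lin_map R (gHom C Y X d) (gr_unit R (d + n)) (p d)"
    and p_ext: "p d \<in> extensional (Hom Y X d)" for d
    by (simp_all add: gr_hom_carrier_iff lin_hom_carrier_iff)
  have "lin_map R (gHom C Y X (- n)) (ring_module R) (p (- n))"
    using p_lin[of "- n"] by (simp add: gr_unit_def)
  from represent[OF X Y this] obtain f where f: "f \<in> Hom X (S Y) n"
    and rep: "\<And>g. g \<in> Hom Y X (- n) \<Longrightarrow> tr Y (gComp C Y X (S Y) (- n) n g f) = p (- n) g"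
    by blast
  have "p d = trace_iso X Y n f d" for d
  proof (rule extensionalityI[OF p_ext])
    show "trace_iso X Y n f d \<in> extensional (Hom Y X d)" using f by (simp add: trace_iso_def)
    fix g assume g: "g \<in> Hom Y X d"
    show "p d g = trace_iso X Y n f d g"
    proof (cases "d + n = 0")
      case True
      then have "d = - n" by simp
      then show ?thesis using f g rep by (simp add: trace_iso_def)
    next
      case False
      then show ?thesis
        using f g lin_mapD(1)[OF p_lin g] by (simp add: trace_iso_def gr_unit_carrier)
    qed
  qed
  then show "\<exists>f\<in>Hom X (S Y) n. p = trace_iso X Y n f" using f by blast
qed

lemma trace_iso_gr_iso:
  assumes "X \<in> gObj C" "Y \<in> gObj C"
  shows "trace_iso X Y \<in> gr_iso R (gHom C X (S Y)) (gr_hom R (gHom C Y X) (gr_unit R))"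
  using trace_iso_linear[OF assms] trace_iso_bij[OF assms]
  by (auto simp: gr_iso_def gr_hom_carrier_iff lin_hom_carrier_iff) (simp add: trace_iso_def)

section \<open>Naturality of the trace isomorphism\<close>

lemma trace_iso_sgn:
  assumes X: "X \<in> gObj C" and Y: "Y \<in> gObj C" and f: "f \<in> Hom X (S Y) n"
  shows "trace_iso X Y n (gr_sgn (gHom C X (S Y) n) k f)
    = (\<lambda>d. \<lambda>g\<in>Hom Y X d. gr_sgn (gr_unit R (d + n)) k (trace_iso X Y n f d g))"
proof (intro ext restrict_ext)
  note SY = S_obj[OF Y]
  have sf: "gr_sgn (gHom C X (S Y) n) k f \<in> Hom X (S Y) n"
    by (rule gr_sgn_closed[OF hom_module[OF X SY] f])
  fix d g
  show "trace_iso X Y n (gr_sgn (gHom C X (S Y) n) k f) d g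
    = (\<lambda>g\<in>Hom Y X d. gr_sgn (gr_unit R (d + n)) k (trace_iso X Y n f d g)) g"
  proof (cases "g \<in> Hom Y X d")
    case False
    then show ?thesis using sf by (simp add: trace_iso_def)
  next
    case g: True
    show ?thesis
    proof (cases "d + n = 0")
      case True
      have "tr Y (gComp C Y X (S Y) d n g (gr_sgn (gHom C X (S Y) n) k f))
          = gr_sgn (ring_module R) k (tr Y (gComp C Y X (S Y) d n g f))"
        by (rule lin_map_sgn[OF trace_comp_linear(2)[OF X Y True g] hom_module[OF X SY]
              module_ring_module[OF base_ring] f])
      then show ?thesis using f sf g True by (simp add: trace_iso_def gr_unit_def)
    next
      case False
      \<comment> \<open>The target is the zero module in this degree, so a signed zero can only be
        zero.\<close>
      then have "gr_sgn (gr_unit R (d + n)) k \<zero>\<^bsub>R\<^esub> = \<zero>\<^bsub>R\<^esub>"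
        using gr_sgn_closed[OF module_gr_unit[OF base_ring], of "\<zero>\<^bsub>R\<^esub>" "d + n" k]
        by (simp add: gr_unit_carrier)
      then show ?thesis using f sf g False by (simp add: trace_iso_def)
    qed
  qed
qed

text \<open>Naturality in the first variable, evaluated at \<open>z\<close>. The sign from the
  opposite category on the left and the sign from duality on the right have the same exponent, so
  what remains is the associativity \<open>x (f z) = (x f) z\<close> under the trace.\<close>

lemma trace_iso_precomp:
  assumes X: "X \<in> gObj C" and X': "X' \<in> gObj C" and Y: "Y \<in> gObj C"
    and f: "f \<in> Hom X' X n" and z: "z \<in> Hom X (S Y) d"
  shows "trace_iso X' Y (d + n)
      (gr_sgn (gHom C X' (S Y) (d + n)) (d * n) (gComp C X' X (S Y) n d f z))
    = gr_sgn (gr_hom R (gHom C Y X') (gr_unit R) (d + n)) (n * d)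
        (gr_comp (gHom C Y X') n (\<lambda>e. \<lambda>x\<in>Hom Y X' e. gComp C Y X' X e n x f) (trace_iso X Y d z))"
    (is "_ = gr_sgn _ _ (gr_comp _ _ ?r _)")
proof -
  note SY = S_obj[OF Y]
  have fz: "gComp C X' X (S Y) n d f z \<in> Hom X' (S Y) (d + n)"
    by (rule comp_closed[OF X' X SY f z]) simp
  have r: "?r \<in> carrier (gr_hom R (gHom C Y X') (gHom C Y X) n)"
    unfolding gr_hom_carrier_iff
    by (intro allI restrict_lin_hom hom_module Y X' comp_linear_left X f)
  have "trace_iso X' Y (d + n) (gComp C X' X (S Y) n d f z) e x
      = trace_iso X Y d z (e + n) (gComp C Y X' X e n x f)"
    if x: "x \<in> Hom Y X' e" for e x
    using comp_closed[OF Y X' X x f refl] comp_assoc[OF Y X' X SY x f z] x fz z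
    by (simp add: trace_iso_def ac_simps)
  moreover have "gr_comp (gHom C Y X') n ?r (trace_iso X Y d z)
      \<in> carrier (gr_hom R (gHom C Y X') (gr_unit R) (d + n))"
    by (rule gr_comp_closed[OF hom_module[OF Y X'] r trace_iso_closed[OF X Y z]])
  note gr_sgn_gr_hom[OF hom_module[OF Y X'] module_gr_unit[OF base_ring] this]
  ultimately show ?thesis
    by (simp add: trace_iso_sgn[OF X' Y fz] gr_comp_def mult.commute fun_eq_iff cong: restrict_cong)
qed

text \<open>Naturality in the second variable, evaluated at \<open>z\<close>. This is where the sign
  in \<open>adjoint_map\<close> has to match the product of the duality sign and the sign of the
  representable functor on the opposite category; away from total degree 0 both sides
  vanish.\<close>

lemma trace_iso_postcomp:
  assumes X: "X \<in> gObj C" and Y: "Y \<in> gObj C" and Y': "Y' \<in> gObj C"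
    and h: "h \<in> Hom Y Y' n" and k: "adjoint_map Y Y' n h k" and z: "z \<in> Hom X (S Y) d"
  shows "trace_iso X Y' (d + n) (gComp C X (S Y) (S Y') d n z k)
    = gr_sgn (gr_hom R (gHom C Y' X) (gr_unit R) (d + n)) (n * d)
        (gr_comp (gHom C Y' X) n
          (\<lambda>e. \<lambda>x\<in>Hom Y' X e. gr_sgn (gHom C Y X (e + n)) (e * n) (gComp C Y Y' X n e h x))
          (trace_iso X Y d z))"
    (is "_ = gr_sgn _ _ (gr_comp _ _ ?l _)")
proof -
  note SY = S_obj[OF Y] and SY' = S_obj[OF Y']
  have k_hom: "k \<in> Hom (S Y) (S Y') n" using k by (simp add: adjoint_map_def)
  have zk: "gComp C X (S Y) (S Y') d n z k \<in> Hom X (S Y') (d + n)"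
    by (rule comp_closed[OF X SY SY' z k_hom refl])
  have "lin_map R (gHom C Y' X e) (gHom C Y X (e + n))
      (\<lambda>x. gr_sgn (gHom C Y X (e + n)) (e * n) (gComp C Y Y' X n e h x))" for e
    using lin_map_compose[OF comp_linear_right[OF Y Y' X h] gr_sgn_linear[OF hom_module[OF Y X]], of e]
    by (simp add: add.commute)
  then have l: "?l \<in> carrier (gr_hom R (gHom C Y' X) (gHom C Y X) n)"
    unfolding gr_hom_carrier_iff by (intro allI restrict_lin_hom hom_module Y' X)
  have eq: "trace_iso X Y' (d + n) (gComp C X (S Y) (S Y') d n z k) e x
      = gr_sgn (gr_unit R (e + (d + n))) (n * d) (trace_iso X Y d z (e + n)
          (gr_sgn (gHom C Y X (e + n)) (e * n) (gComp C Y Y' X n e h x)))"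
    if x: "x \<in> Hom Y' X e" for e x
  proof -
    have hx: "gComp C Y Y' X n e h x \<in> Hom Y X (e + n)"
      by (rule comp_closed[OF Y Y' X h x]) simp
    have shx: "gr_sgn (gHom C Y X (e + n)) (e * n) (gComp C Y Y' X n e h x) \<in> Hom Y X (e + n)"
      by (rule gr_sgn_closed[OF hom_module[OF Y X] hx])
    show ?thesis
    proof (cases "e + (d + n) = 0")
      case True
      then have deg: "e + n + d = 0" and n: "n = - (d + e)" by simp_all
      let ?t = "tr Y (gComp C Y X (S Y) (e + n) d (gComp C Y Y' X n e h x) z)"
      have t: "?t \<in> carrier (ring_module R)"
        by (rule lin_mapD(1)[OF trace_comp_linear(1)[OF X Y deg z] hx])
      have "tr Y' (gComp C Y' X (S Y') e (d + n) x (gComp C X (S Y) (S Y') d n z k))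
          = gr_sgn (ring_module R) n ?t"
        using adjoint_map_trace[OF X Y Y' h x z _ k] deg by (simp add: ac_simps)
      \<comment> \<open>Since \<open>d + e = - n\<close>, the exponent \<open>n * d + e * n\<close>
        is minus the square of \<open>n\<close> and has the parity of \<open>n\<close>.\<close>
      also have "\<dots> = gr_sgn (ring_module R) (n * d + e * n) ?t"
        by (rule gr_sgn_cong) (auto simp: n)
      also have "\<dots> = gr_sgn (ring_module R) (n * d) (gr_sgn (ring_module R) (e * n) ?t)"
        by (rule gr_sgn_gr_sgn[OF module_ring_module[OF base_ring] t, symmetric])
      also have "gr_sgn (ring_module R) (e * n) ?t = tr Y (gComp C Y X (S Y) (e + n) d
          (gr_sgn (gHom C Y X (e + n)) (e * n) (gComp C Y Y' X n e h x)) z)"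
        by (rule lin_map_sgn[OF trace_comp_linear(1)[OF X Y deg z] hom_module[OF Y X]
              module_ring_module[OF base_ring] hx, symmetric])
      finally show ?thesis
        using True deg x zk z shx by (simp add: trace_iso_def gr_unit_def)
    next
      case False
      then have "gr_sgn (gr_unit R (e + (d + n))) (n * d) \<zero>\<^bsub>R\<^esub> = \<zero>\<^bsub>R\<^esub>"
        using gr_sgn_closed[OF module_gr_unit[OF base_ring], of "\<zero>\<^bsub>R\<^esub>" "e + (d + n)" "n * d"]
        by (simp add: gr_unit_carrier)
      moreover have "e + n + d \<noteq> 0" using False by simp
      ultimately show ?thesis using False x zk z shx by (simp add: trace_iso_def)
    qed
  qed
  have "gr_comp (gHom C Y' X) n ?l (trace_iso X Y d z)
      \<in> carrier (gr_hom R (gHom C Y' X) (gr_unit R) (d + n))"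
    by (rule gr_comp_closed[OF hom_module[OF Y' X] l trace_iso_closed[OF X Y z]])
  note sgn = gr_sgn_gr_hom[OF hom_module[OF Y' X] module_gr_unit[OF base_ring] this]
  show ?thesis unfolding sgn
  proof
    fix e
    show "trace_iso X Y' (d + n) (gComp C X (S Y) (S Y') d n z k) e
      = (\<lambda>x\<in>Hom Y' X e. gr_sgn (gr_unit R (e + (d + n))) (n * d)
          (gr_comp (gHom C Y' X) n ?l (trace_iso X Y d z) e x))"
    proof (rule extensionalityI)
      show "trace_iso X Y' (d + n) (gComp C X (S Y) (S Y') d n z k) e \<in> extensional (Hom Y' X e)"
        using zk by (simp add: trace_iso_def)
    qed (simp_all add: eq gr_comp_def)
  qed
qed

section \<open>Assembly of the graded Serre functor\<close>

lemma adjoint_map_right_serre: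
  assumes on: "gOn F = S"
    and adj: "\<And>Y Y' n h. \<lbrakk>Y \<in> gObj C; Y' \<in> gObj C; h \<in> Hom Y Y' n\<rbrakk>
      \<Longrightarrow> adjoint_map Y Y' n h (gMap F Y Y' n h)"
  shows "right_serre_gr_functor R C F"
  unfolding right_serre_gr_functor_def
proof (intro conjI exI[of _ trace_iso] ballI)
  show "gr_functor R C C F"
    by (rule adjoint_map_gr_functor[OF on adj])
  note serre_defs = gr_hom_into_def gr_hom_from_def gr_op_def gr_fun_comp_def gr_fun_op_def gr_dual_def
  have iso: "trace_iso X Y \<in> carrier (gr_hom R (gHom C X (S Y)) (gr_hom R (gHom C Y X) (gr_unit R)) 0)"
    if "X \<in> gObj C" "Y \<in> gObj C" for X Y
    using trace_iso_gr_iso[OF that] by (simp add: gr_iso_def)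
  show "trace_iso X Y \<in> gr_iso R (gHom C X (gOn F Y)) (gr_hom R (gHom C Y X) (gr_unit R))"
    if "X \<in> gObj C" "Y \<in> gObj C" for X Y
    using trace_iso_gr_iso[OF that] by (simp add: on)
  show "gr_natural R (gr_op C) (gr_hom_into C (gOn F Y))
      (gr_fun_comp (gr_fun_op (gr_hom_from C Y)) (gr_dual R)) (\<lambda>X. trace_iso X Y)"
    if Y: "Y \<in> gObj C" for Y
    unfolding gr_natural_def
  proof (intro conjI ballI allI)
    fix X assume "X \<in> gObj (gr_op C)"
    then show "trace_iso X Y \<in> carrier (gr_hom R (gOn (gr_hom_into C (gOn F Y)) X)
        (gOn (gr_fun_comp (gr_fun_op (gr_hom_from C Y)) (gr_dual R)) X) 0)"
      using iso[of X Y] Y by (simp add: serre_defs on)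
  next
    fix X X' n f
    assume "X \<in> gObj (gr_op C)" "X' \<in> gObj (gr_op C)" "f \<in> carrier (gHom (gr_op C) X X' n)"
    then have X: "X \<in> gObj C" and X': "X' \<in> gObj C" and f: "f \<in> Hom X' X n"
      by (simp_all add: gr_op_def)
    show "gr_comp (gOn (gr_hom_into C (gOn F Y)) X) n (gMap (gr_hom_into C (gOn F Y)) X X' n f)
          (trace_iso X' Y)
        = gr_comp (gOn (gr_hom_into C (gOn F Y)) X) 0 (trace_iso X Y)
          (gMap (gr_fun_comp (gr_fun_op (gr_hom_from C Y)) (gr_dual R)) X X' n f)"
      \<comment> \<open>Only the outer composites are unfolded. The one hidden in
        \<open>gr_dual\<close> stays folded, in the form used by \<open>trace_iso_precomp\<close>;
        the second naturality square below is treated alike.\<close>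
      unfolding gr_comp_def[of _ 0] gr_comp_def[of "gOn _ _"]
      by (intro ext restrict_ext)
        (simp add: serre_defs on trace_iso_precomp[OF X X' Y f] trace_iso_closed[OF X Y])
  qed
  show "gr_natural R C (gr_fun_comp F (gr_hom_from C X))
      (gr_fun_comp (gr_fun_op (gr_hom_into C X)) (gr_dual R)) (\<lambda>Y. trace_iso X Y)"
    if X: "X \<in> gObj C" for X
    unfolding gr_natural_def
  proof (intro conjI ballI allI)
    fix Y assume "Y \<in> gObj C"
    then show "trace_iso X Y \<in> carrier (gr_hom R (gOn (gr_fun_comp F (gr_hom_from C X)) Y)
        (gOn (gr_fun_comp (gr_fun_op (gr_hom_into C X)) (gr_dual R)) Y) 0)"
      using iso[of X Y] X by (simp add: serre_defs on)
  next
    fix Y Y' n h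
    assume Y: "Y \<in> gObj C" and Y': "Y' \<in> gObj C" and h: "h \<in> Hom Y Y' n"
    show "gr_comp (gOn (gr_fun_comp F (gr_hom_from C X)) Y) n
          (gMap (gr_fun_comp F (gr_hom_from C X)) Y Y' n h) (trace_iso X Y')
        = gr_comp (gOn (gr_fun_comp F (gr_hom_from C X)) Y) 0 (trace_iso X Y)
          (gMap (gr_fun_comp (gr_fun_op (gr_hom_into C X)) (gr_dual R)) Y Y' n h)"
      unfolding gr_comp_def[of _ 0] gr_comp_def[of "gOn _ _"]
      by (intro ext restrict_ext)
        (simp add: serre_defs on trace_iso_postcomp[OF X Y Y' h adj[OF Y Y' h]]
          trace_iso_closed[OF X Y])
  qed
qed

end

section \<open>The trace of a Serre functor\<close>

theorem proposition2p21:
  fixes R :: "'r ring"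
    and C :: "('o, 'r, 'm) gr_cat"
    and S0 :: "('o, 'o, 'm, 'm) k_fun"
  assumes "cring R"
    and "gr_category R C"
    and "closed_under_shifts C"
    and "right_serre_k_functor R (degree0_cat C) S0"
  shows "\<exists>S. right_serre_gr_functor R C S \<and> degree0_fun S = S0"
proof -
  interpret gr_category R C by fact
  let ?S = "kOn S0"
  have degree0: "kObj (degree0_cat C) = gObj C" "kHom (degree0_cat C) X Y = gHom C X Y 0" for X Y
    by (simp_all add: degree0_cat_def)
  obtain \<psi> where S0_functor: "k_functor R (degree0_cat C) (degree0_cat C) S0"
    and iso: "\<And>X Y. \<lbrakk>X \<in> gObj C; Y \<in> gObj C\<rbrakk> \<Longrightarrow>
      \<psi> X Y \<in> lin_iso R (gHom C X (?S Y) 0) (lin_hom R (gHom C Y X 0) (ring_module R))"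
    and nat1: "\<And>Y. Y \<in> gObj C \<Longrightarrow> k_natural R (k_op (degree0_cat C))
      (k_hom_into (degree0_cat C) (?S Y))
      (k_fun_comp (k_fun_op (k_hom_from (degree0_cat C) Y)) (k_dual R)) (\<lambda>X. \<psi> X Y)"
    and nat2: "\<And>X. X \<in> gObj C \<Longrightarrow> k_natural R (degree0_cat C)
      (k_fun_comp S0 (k_hom_from (degree0_cat C) X))
      (k_fun_comp (k_fun_op (k_hom_into (degree0_cat C) X)) (k_dual R)) (\<lambda>Y. \<psi> X Y)"
    using assms(4) unfolding right_serre_k_functor_def degree0 by blast
  interpret S0: k_functor R "degree0_cat C" "degree0_cat C" S0 by (rule S0_functor)
  have S_obj: "?S Y \<in> gObj C" if "Y \<in> gObj C" for Y
    using S0.on_obj[of Y] that by (simp add: degree0_cat_def)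
  have \<psi>_hom: "\<psi> X Y w \<in> carrier (lin_hom R (gHom C Y X 0) (ring_module R))"
    if "X \<in> gObj C" "Y \<in> gObj C" "w \<in> Hom X (?S Y) 0" for X Y w
    using iso[OF that(1,2)] that(3) by (auto simp: lin_iso_def bij_betw_def)
  have pre: "\<psi> X' Y (gComp C X' X (?S Y) 0 0 f w) g = \<psi> X Y w (gComp C Y X' X 0 0 g f)"
    if "X \<in> gObj C" "X' \<in> gObj C" "Y \<in> gObj C"
      "f \<in> Hom X' X 0" "w \<in> Hom X (?S Y) 0" "g \<in> Hom Y X' 0" for X X' Y f w g
  proof -
    have "\<psi> X' Y (kMap (k_hom_into (degree0_cat C) (?S Y)) X X' f w)
        = kMap (k_fun_comp (k_fun_op (k_hom_from (degree0_cat C) Y)) (k_dual R)) X X' f (\<psi> X Y w)"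
      using nat1[OF that(3)] that unfolding k_natural_def
      by (auto simp: k_op_def degree0_cat_def k_hom_into_def)
    from fun_cong[OF this, of g] show ?thesis
      using that \<psi>_hom[OF that(1,3,5)]
      by (simp add: degree0_cat_def k_hom_into_def k_hom_from_def k_fun_comp_def k_fun_op_def k_dual_def)
  qed
  have post: "\<psi> X Y' (gComp C X (?S Y) (?S Y') 0 0 w (kMap S0 Y Y' h)) g
      = \<psi> X Y w (gComp C Y Y' X 0 0 h g)"
    if "X \<in> gObj C" "Y \<in> gObj C" "Y' \<in> gObj C"
      "h \<in> Hom Y Y' 0" "w \<in> Hom X (?S Y) 0" "g \<in> Hom Y' X 0" for X Y Y' h w g
  proof -
    have "\<psi> X Y' (kMap (k_fun_comp S0 (k_hom_from (degree0_cat C) X)) Y Y' h w)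
        = kMap (k_fun_comp (k_fun_op (k_hom_into (degree0_cat C) X)) (k_dual R)) Y Y' h (\<psi> X Y w)"
      using nat2[OF that(1)] that unfolding k_natural_def
      by (auto simp: degree0_cat_def k_hom_from_def k_fun_comp_def)
    from fun_cong[OF this, of g] show ?thesis
      using that \<psi>_hom[OF that(1,2,5)]
      by (simp add: degree0_cat_def k_hom_into_def k_hom_from_def k_fun_comp_def k_fun_op_def k_dual_def)
  qed
  \<comment> \<open>As in the Yoneda lemma, evaluation at the identity loses nothing: naturality in
    the first variable gives \<open>\<psi> f g = \<psi> (g f) id\<close>, so the traces determine
    \<open>\<psi>\<close>.\<close>
  define tr where "tr Y f = \<psi> Y Y f (gId C Y)" for Y f
  have tr: "tr Y (gComp C Y X (?S Y) 0 0 g f) = \<psi> X Y f g"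
    if "X \<in> gObj C" "Y \<in> gObj C" "g \<in> Hom Y X 0" "f \<in> Hom X (?S Y) 0" for X Y f g
    using pre[OF that(1,2,2,3,4) id_closed[OF that(2)]] id_left[OF that(2,1,3)] by (simp add: tr_def)
  interpret graded_trace R C ?S tr
  proof
    show "closed_under_shifts C" by fact
    show "?S Y \<in> gObj C" if "Y \<in> gObj C" for Y by (rule S_obj[OF that])
    show "lin_map R (gHom C Y (?S Y) 0) (ring_module R) (tr Y)" if Y: "Y \<in> gObj C" for Y
    proof (rule lin_mapI)
      have lin: "lin_map R (gHom C Y (?S Y) 0) (lin_hom R (gHom C Y Y 0) (ring_module R)) (\<psi> Y Y)"
        using iso[OF Y Y] by (simp add: lin_iso_def lin_hom_carrier_iff)
      show "tr Y x \<in> carrier (ring_module R)" if "x \<in> Hom Y (?S Y) 0" for x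
        using \<psi>_hom[OF Y Y that] id_closed[OF Y]
        by (auto simp: tr_def lin_hom_carrier_iff dest: lin_mapD(1))
      show "tr Y (x \<oplus>\<^bsub>gHom C Y (?S Y) 0\<^esub> y) = tr Y x \<oplus>\<^bsub>ring_module R\<^esub> tr Y y"
        if "x \<in> Hom Y (?S Y) 0" "y \<in> Hom Y (?S Y) 0" for x y
        using lin_mapD(2)[OF lin that] id_closed[OF Y] by (simp add: tr_def lin_hom_def)
      show "tr Y (a \<odot>\<^bsub>gHom C Y (?S Y) 0\<^esub> x) = a \<odot>\<^bsub>ring_module R\<^esub> tr Y x"
        if "a \<in> carrier R" "x \<in> Hom Y (?S Y) 0" for a x
        using lin_mapD(3)[OF lin that] id_closed[OF Y] by (simp add: tr_def lin_hom_def)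
    qed
    show "f = f'" if X: "X \<in> gObj C" and Y: "Y \<in> gObj C"
      and f: "f \<in> Hom X (?S Y) 0" and f': "f' \<in> Hom X (?S Y) 0"
      and eq: "\<And>g. g \<in> Hom Y X 0 \<Longrightarrow>
        tr Y (gComp C Y X (?S Y) 0 0 g f) = tr Y (gComp C Y X (?S Y) 0 0 g f')" for X Y f f'
    proof -
      \<comment> \<open>Values of \<open>\<psi>\<close> are extensional, so agreement of the traces
        on all of \<open>C(Y, X)\<close> in degree 0 is equality of functionals, and injectivity of
        \<open>\<psi>\<close> applies.\<close>
      have "\<psi> X Y f = \<psi> X Y f'"
        by (rule extensionalityI[of _ "Hom Y X 0"])
          (use \<psi>_hom[OF X Y] f f' eq tr[OF X Y] in \<open>simp_all add: lin_hom_carrier_iff\<close>)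
      then show ?thesis
        using iso[OF X Y] f f' by (auto simp: lin_iso_def bij_betw_def dest: inj_onD)
    qed
    show "\<exists>f\<in>Hom X (?S Y) 0. \<forall>g\<in>Hom Y X 0. tr Y (gComp C Y X (?S Y) 0 0 g f) = \<phi> g"
      if X: "X \<in> gObj C" and Y: "Y \<in> gObj C"
        and \<phi>: "lin_map R (gHom C Y X 0) (ring_module R) \<phi>" for X Y \<phi>
    proof -
      \<comment> \<open>\<open>\<phi>\<close> is arbitrary off the carrier; its restriction is the
        member of \<open>lin_hom\<close> that lies in the image of \<open>\<psi>\<close>.\<close>
      have "(\<lambda>g\<in>Hom Y X 0. \<phi> g) \<in> \<psi> X Y ` Hom X (?S Y) 0"
        using restrict_lin_hom[OF hom_module[OF Y X] \<phi>] iso[OF X Y]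
        by (simp add: lin_iso_def bij_betw_def)
      then obtain f where f: "f \<in> Hom X (?S Y) 0" and "(\<lambda>g\<in>Hom Y X 0. \<phi> g) = \<psi> X Y f"
        by blast
      then have "\<psi> X Y f g = \<phi> g" if "g \<in> Hom Y X 0" for g
        using that by (metis restrict_apply')
      then show ?thesis using f tr[OF X Y] by auto
    qed
  qed
  \<comment> \<open>In degree 0 the action of \<open>S0\<close> is kept verbatim. Adjoints chosen
    there would agree with it on morphisms only, whereas \<open>degree0_fun ?F = S0\<close> is an
    equality of records and concerns all arguments.\<close>
  let ?F = "\<lparr>gOn = ?S, gMap = \<lambda>Y Y' n h.
    if n = 0 then kMap S0 Y Y' h else SOME k. adjoint_map Y Y' n h k\<rparr>"
  have "adjoint_map Y Y' n h (gMap ?F Y Y' n h)"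
    if Y: "Y \<in> gObj C" and Y': "Y' \<in> gObj C" and h: "h \<in> Hom Y Y' n" for Y Y' n h
  proof (cases "n = 0")
    case False
    then show ?thesis using someI_ex[OF adjoint_map_exists[OF Y Y' h]] by simp
  next
    case True
    note SY = S_obj[OF Y] and SY' = S_obj[OF Y']
    have h0: "h \<in> Hom Y Y' 0" using h True by simp
    have k: "kMap S0 Y Y' h \<in> Hom (?S Y) (?S Y') 0"
      using lin_mapD(1)[OF S0.map_linear[of Y Y']] Y Y' h0 by (simp add: degree0_cat_def)
    \<comment> \<open>Naturality in the second variable, applied to the identity of
      \<open>?S Y\<close>, says that \<open>S0\<close> already produces adjoints; in degree 0 the
      sign in \<open>adjoint_map\<close> is trivial.\<close>
    have "tr Y' (gComp C Y' (?S Y) (?S Y') 0 0 g (kMap S0 Y Y' h))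
        = tr Y (gComp C Y Y' (?S Y) 0 0 h g)" if g: "g \<in> Hom Y' (?S Y) 0" for g
    proof -
      have hg: "gComp C Y Y' (?S Y) 0 0 h g \<in> Hom Y (?S Y) 0"
        by (rule comp_closed[OF Y Y' SY h0 g]) simp
      show ?thesis
        using post[OF SY Y Y' h0 id_closed[OF SY] g] tr[OF SY Y' g k]
          tr[OF SY Y hg id_closed[OF SY]] id_left[OF SY SY' k] id_right[OF Y SY hg] by simp
    qed
    then show ?thesis using True k by (simp add: adjoint_map_def gr_sgn_def)
  qed
  then have "right_serre_gr_functor R C ?F"
    by (intro adjoint_map_right_serre) simp_all
  moreover have "degree0_fun ?F = S0"
    by (simp add: degree0_fun_def)
  ultimately show ?thesis by blast
qed

end
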